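(* Let $\omega=\omega(f_1,\dots,f_{\mu-1}|a_\mu,\dots,a_\nu)$, where $1\le\mu\le\nu+1$, $f_1,\dots,f_{\mu-1}\in\mathbb{C}[t_1^{\pm1},\dots,t_{\mu-1}^{\pm1}]$ and $a_\mu,\dots,a_\nu$ are nonzero complex numbers. Then $M_\omega$ is a simple $A$-module if and only if there exist Laurent polynomials $P\in\mathbb{C}[t_1^{\pm1},\dots,t_{\mu-1}^{\pm1}]$ and $P_j(t_j)\in\mathbb{C}[t_j^{\pm1}]$ such that $f_j=t_j\partial_jP+P_j(t_j)$ for $j=1,\dots,\mu-1$. Moreover, if $M_{\omega_1}$ and $M_{\omega_2}$ are $A$-modules with $\omega_1=\omega_1(f_1,\dots,f_{\mu-1}|a_\mu,\dots,a_\nu)$ and $\omega_2=\omega_2(g_1,\dots,g_{\gamma-1}|b_\gamma,\dots,b_\nu)$, then $M_{\omega_1}\cong M_{\omega_2}$ as $A$-modules if and only if $\mu=\gamma$, $a_j=b_j$ for $\mu\le j\le\nu$, and $f_j-g_j\in\mathbb{Z}$ for $1\le j\le\mu-1$.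
   Context: Fix an integer $\nu\ge1$. Let $L_C=\bigoplus_{i=1}^{\nu}\mathbb{Z}c_i$, $L_D=\bigoplus_{i=1}^{\nu}\mathbb{Z}d_i$, with symmetric bilinear form on $L_C\oplus L_D$ given by $(c_i,d_j)=\delta_{ij}$, $(c_i,c_j)=(d_i,d_j)=0$. $B$ is the unital associative $\mathbb{C}$-algebra generated by $e_\alpha$ ($\alpha\in L_C$) and $d_i$ ($1\le i\le\nu$) subject to $e_0=1$, $e_{\alpha+\beta}=e_\alpha e_\beta$, $d_ie_\alpha-e_\alpha d_i=(d_i,\alpha)e_\alpha$. $A$ is the quotient of $B$ by the relations $d_id_j=d_jd_i$ for all $i,j$. For $1\le\mu\le\nu+1$, $f_1,\dots,f_{\mu-1}\in\mathbb{C}[t_1^{\pm1},\dots,t_{\mu-1}^{\pm1}]$ and nonzero $a_\mu,\dots,a_\nu\in\mathbb{C}$, $\omega=\omega(f_1,\dots,f_{\mu-1}|a_\mu,\dots,a_\nu)$ is a formal symbol and $$M_\omega=\mathbb{C}[t_1^{\pm1},\dots,t_{\mu-1}^{\pm1},t_\mu,\dots,t_\nu]\,\omega$$ is the free rank one module over this ring, made a $B$-module as follows: for $\alpha=\sum_{i=1}^{\nu}m_ic_i\in L_C$ and $f\in\mathbb{C}[t_1^{\pm1},\dots,t_{\mu-1}^{\pm1},t_\mu,\dots,t_\nu]$, $$e_\alpha.f\omega=\Big[\Big(\prod_{i=1}^{\mu-1}t_i^{m_i}\Big)\prod_{i=\mu}^{\nu}(a_ie^{-\partial_i})^{m_i}f\Big]\omega,$$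 $d_j.f\omega=(t_j\partial_jf+f_jf)\omega$ for $1\le j\le\mu-1$, and $d_j.f\omega=t_jf\omega$ for $\mu\le j\le\nu$. Here $\partial_i=\partial/\partial t_i$, so $e^{-\partial_i}$ is the substitution $t_i\mapsto t_i-1$. "$M_\omega$ is an $A$-module" means that the $B$-action factors through $A$. The symbol for $\omega_2$ has $1\le\gamma\le\nu+1$, $g_i\in\mathbb{C}[t_1^{\pm1},\dots,t_{\gamma-1}^{\pm1}]$, $b_i\in\mathbb{C}\setminus\{0\}$. *)

theory Defs
  imports Complex_Main "HOL-Library.Poly_Mapping" "HOL-Algebra.QuotRing" "HOL-Algebra.Module"
begin

section \<open>Left modules over a not necessarily commutative ring\<close>

text \<open>
  The locale \<^locale>\<open>module\<close> insists on a commutative ring of scalars. We keep its record type and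
  its axioms, and only drop commutativity. (\<^locale>\<open>submodule\<close> needs no commutativity and is used
  as it stands.) As in \<^locale>\<open>module\<close>, the fields \<^const>\<open>mult\<close> and \<^const>\<open>one\<close> of the
  module record play no role.
\<close>

locale left_module = R?: ring R + M?: abelian_group M
  for R (structure) and M :: "('a, 'b, 'm) module_scheme" (structure) +
  assumes smult_closed:
      "\<lbrakk>a \<in> carrier R; x \<in> carrier M\<rbrakk> \<Longrightarrow> a \<odot>\<^bsub>M\<^esub> x \<in> carrier M"
    and smult_l_distr:
      "\<lbrakk>a \<in> carrier R; b \<in> carrier R; x \<in> carrier M\<rbrakk> \<Longrightarrow>
       (a \<oplus>\<^bsub>R\<^esub> b) \<odot>\<^bsub>M\<^esub> x = a \<odot>\<^bsub>M\<^esub> x \<oplus>\<^bsub>M\<^esub> b \<odot>\<^bsub>M\<^esub> x"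
    and smult_r_distr:
      "\<lbrakk>a \<in> carrier R; x \<in> carrier M; y \<in> carrier M\<rbrakk> \<Longrightarrow>
       a \<odot>\<^bsub>M\<^esub> (x \<oplus>\<^bsub>M\<^esub> y) = a \<odot>\<^bsub>M\<^esub> x \<oplus>\<^bsub>M\<^esub> a \<odot>\<^bsub>M\<^esub> y"
    and smult_assoc1:
      "\<lbrakk>a \<in> carrier R; b \<in> carrier R; x \<in> carrier M\<rbrakk> \<Longrightarrow>
       (a \<otimes>\<^bsub>R\<^esub> b) \<odot>\<^bsub>M\<^esub> x = a \<odot>\<^bsub>M\<^esub> (b \<odot>\<^bsub>M\<^esub> x)"
    and smult_one:
      "x \<in> carrier M \<Longrightarrow> \<one>\<^bsub>R\<^esub> \<odot>\<^bsub>M\<^esub> x = x"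

definition simple_module :: "('a, 'r) ring_scheme \<Rightarrow> ('a, 'b) module \<Rightarrow> bool" where
  "simple_module R M \<longleftrightarrow>
     left_module R M \<and> carrier M \<noteq> {\<zero>\<^bsub>M\<^esub>} \<and>
     (\<forall>N. submodule N R M \<longrightarrow> N = {\<zero>\<^bsub>M\<^esub>} \<or> N = carrier M)"

definition module_hom :: "('a, 'r) ring_scheme \<Rightarrow> ('a, 'b) module \<Rightarrow> ('a, 'c) module \<Rightarrow> ('b \<Rightarrow> 'c) set"
  where
  "module_hom R M N =
     {\<phi>. (\<forall>x\<in>carrier M. \<phi> x \<in> carrier N) \<and>
         (\<forall>x\<in>carrier M. \<forall>y\<in>carrier M. \<phi> (x \<oplus>\<^bsub>M\<^esub> y) = \<phi> x \<oplus>\<^bsub>N\<^esub> \<phi> y) \<and>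
         (\<forall>r\<in>carrier R. \<forall>x\<in>carrier M. \<phi> (r \<odot>\<^bsub>M\<^esub> x) = r \<odot>\<^bsub>N\<^esub> \<phi> x)}"

definition module_isomorphic :: "('a, 'r) ring_scheme \<Rightarrow> ('a, 'b) module \<Rightarrow> ('a, 'c) module \<Rightarrow> bool"
  where
  "module_isomorphic R M N \<longleftrightarrow>
     (\<exists>\<phi>\<in>module_hom R M N. bij_betw \<phi> (carrier M) (carrier N))"

definition is_induced_action ::
    "('a, 'r) ring_scheme \<Rightarrow> 'a set \<Rightarrow> ('a, 'b) module \<Rightarrow> ('a set \<Rightarrow> 'b \<Rightarrow> 'b) \<Rightarrow> bool" where
  "is_induced_action R I M act \<longleftrightarrow>
     (\<forall>r\<in>carrier R. \<forall>x\<in>carrier M. act (I +>\<^bsub>R\<^esub> r) x = r \<odot>\<^bsub>M\<^esub> x)"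

definition factors_through_quotient ::
    "('a, 'r) ring_scheme \<Rightarrow> 'a set \<Rightarrow> ('a, 'b) module \<Rightarrow> bool" where
  "factors_through_quotient R I M \<longleftrightarrow> (\<exists>act. is_induced_action R I M act)"

text \<open>
  The module over \<^term>\<open>R Quot I\<close> with the same underlying group. It is meaningful only if the
  action of \<open>R\<close> factors through \<^term>\<open>R Quot I\<close>; the induced action is then unique on the carriers.
\<close>

definition quotient_module ::
    "('a, 'r) ring_scheme \<Rightarrow> 'a set \<Rightarrow> ('a, 'b) module \<Rightarrow> ('a set, 'b) module" where
  "quotient_module R I M =
     \<lparr>carrier = carrier M, mult = mult M, one = one M, zero = zero M, add = add M,
      smult = (SOME act. is_induced_action R I M act)\<rparr>"


section \<open>Free associative algebras\<close>

text \<open>The free monoid on a type, written additively so that finitely supported functions on it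
  with their convolution product form the free unital associative algebra.\<close>

datatype 'g free_mon = Word (letters: "'g list")

instantiation free_mon :: (type) monoid_add
begin

definition zero_free_mon :: "'a free_mon" where
  "0 = Word []"

definition plus_free_mon :: "'a free_mon \<Rightarrow> 'a free_mon \<Rightarrow> 'a free_mon" where
  "u + v = Word (letters u @ letters v)"

instance
  by standard (simp_all add: zero_free_mon_def plus_free_mon_def)

end

definition gen :: "'g \<Rightarrow> 'g free_mon \<Rightarrow>\<^sub>0 complex" where
  "gen x = Poly_Mapping.single (Word [x]) 1"

definition free_algebra :: "'g set \<Rightarrow> ('g free_mon \<Rightarrow>\<^sub>0 complex) ring" where
  "free_algebra X =
     \<lparr>carrier = {p. \<forall>w\<in>Poly_Mapping.keys p. set (letters w) \<subseteq> X},
      mult = (*), one = 1, zero = 0, add = (+)\<rparr>"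


section \<open>The algebras $B$ and $A$\<close>

text \<open>A finitely supported \<open>m\<close> stands for \<open>\<Sum>\<^sub>i m\<^sub>i c\<^sub>i\<close> in \<open>L\<^sub>C\<close> (or \<open>\<Sum>\<^sub>i m\<^sub>i d\<^sub>i\<close> in \<open>L\<^sub>D\<close>).\<close>

type_synonym lattice = "nat \<Rightarrow>\<^sub>0 int"

definition lattice_of_rank :: "nat \<Rightarrow> lattice set" where
  "lattice_of_rank \<nu> = {m. Poly_Mapping.keys m \<subseteq> {1..\<nu>}}"

definition in_LC :: "lattice \<Rightarrow> lattice \<times> lattice" where
  "in_LC \<alpha> = (\<alpha>, 0)"

definition d_vec :: "nat \<Rightarrow> lattice \<times> lattice" where
  "d_vec i = (0, Poly_Mapping.single i 1)"

text \<open>The symmetric bilinear form on \<open>L\<^sub>C \<oplus> L\<^sub>D\<close> with \<open>(c\<^sub>i, d\<^sub>j) = \<delta>\<^sub>i\<^sub>j\<close> and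
  \<open>(c\<^sub>i, c\<^sub>j) = (d\<^sub>i, d\<^sub>j) = 0\<close>.\<close>

definition bform :: "nat \<Rightarrow> lattice \<times> lattice \<Rightarrow> lattice \<times> lattice \<Rightarrow> int" where
  "bform \<nu> x y =
     (\<Sum>i=1..\<nu>. Poly_Mapping.lookup (fst x) i * Poly_Mapping.lookup (snd y) i
              + Poly_Mapping.lookup (snd x) i * Poly_Mapping.lookup (fst y) i)"

datatype generator = E lattice | D nat

type_synonym free_elt = "generator free_mon \<Rightarrow>\<^sub>0 complex"

definition generators :: "nat \<Rightarrow> generator set" where
  "generators \<nu> = E ` lattice_of_rank \<nu> \<union> D ` {1..\<nu>}"

abbreviation freeB :: "nat \<Rightarrow> free_elt ring" where
  "freeB \<nu> \<equiv> free_algebra (generators \<nu>)"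

definition relB :: "nat \<Rightarrow> free_elt set" where
  "relB \<nu> =
     {gen (E 0) - 1} \<union>
     {gen (E (\<alpha> + \<beta>)) - gen (E \<alpha>) * gen (E \<beta>) | \<alpha> \<beta>.
        \<alpha> \<in> lattice_of_rank \<nu> \<and> \<beta> \<in> lattice_of_rank \<nu>} \<union>
     {gen (D i) * gen (E \<alpha>) - gen (E \<alpha>) * gen (D i)
        - of_int (bform \<nu> (d_vec i) (in_LC \<alpha>)) * gen (E \<alpha>) | i \<alpha>.
        i \<in> {1..\<nu>} \<and> \<alpha> \<in> lattice_of_rank \<nu>}"

definition idealB :: "nat \<Rightarrow> free_elt set" where
  "idealB \<nu> = Idl\<^bsub>freeB \<nu>\<^esub> (relB \<nu>)"

definition algB :: "nat \<Rightarrow> free_elt set ring" where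
  "algB \<nu> = freeB \<nu> Quot idealB \<nu>"

definition dB :: "nat \<Rightarrow> nat \<Rightarrow> free_elt set" where
  "dB \<nu> i = idealB \<nu> +>\<^bsub>freeB \<nu>\<^esub> gen (D i)"

definition idealA :: "nat \<Rightarrow> free_elt set set" where
  "idealA \<nu> =
     Idl\<^bsub>algB \<nu>\<^esub> {dB \<nu> i \<otimes>\<^bsub>algB \<nu>\<^esub> dB \<nu> j \<ominus>\<^bsub>algB \<nu>\<^esub> dB \<nu> j \<otimes>\<^bsub>algB \<nu>\<^esub> dB \<nu> i | i j.
               i \<in> {1..\<nu>} \<and> j \<in> {1..\<nu>}}"

definition algA :: "nat \<Rightarrow> free_elt set set ring" where
  "algA \<nu> = algB \<nu> Quot idealA \<nu>"


section \<open>Laurent polynomials\<close>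

text \<open>Laurent polynomials in \<open>t\<^sub>0, t\<^sub>1, \<dots>\<close>, as finitely supported functions on exponent vectors.\<close>

type_synonym laurent = "(nat \<Rightarrow>\<^sub>0 int) \<Rightarrow>\<^sub>0 complex"

definition const :: "complex \<Rightarrow> laurent" where
  "const c = Poly_Mapping.single 0 c"

definition var_pow :: "nat \<Rightarrow> int \<Rightarrow> laurent" where
  "var_pow i m = Poly_Mapping.single (Poly_Mapping.single i m) 1"

abbreviation var :: "nat \<Rightarrow> laurent" where
  "var i \<equiv> var_pow i 1"

definition laurent_in :: "nat set \<Rightarrow> laurent set" where
  "laurent_in X = {f. \<forall>k\<in>Poly_Mapping.keys f. Poly_Mapping.keys k \<subseteq> X}"

text \<open>$\mathbb{C}[t_1^{\pm1},\dots,t_{\mu-1}^{\pm1},t_\mu,\dots,t_\nu]$\<close>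

definition mixed_ring :: "nat \<Rightarrow> nat \<Rightarrow> laurent set" where
  "mixed_ring \<nu> \<mu> =
     {f \<in> laurent_in {1..\<nu>}.
        \<forall>k\<in>Poly_Mapping.keys f. \<forall>i\<in>{\<mu>..\<nu>}. Poly_Mapping.lookup k i \<ge> 0}"

definition partial :: "nat \<Rightarrow> laurent \<Rightarrow> laurent" where
  "partial j f =
     (\<Sum>k\<in>Poly_Mapping.keys f.
        Poly_Mapping.single (k - Poly_Mapping.single j 1)
          (of_int (Poly_Mapping.lookup k j) * Poly_Mapping.lookup f k))"

text \<open>The substitution \<open>t\<^sub>i \<mapsto> t\<^sub>i - s\<close>, for \<open>f\<close> without negative powers of \<open>t\<^sub>i\<close>: the factor
  \<open>t\<^sub>i ^ k\<^sub>i\<close> of each monomial is replaced by \<open>(t\<^sub>i - s) ^ k\<^sub>i\<close>.\<close>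

definition subst_shift :: "nat \<Rightarrow> complex \<Rightarrow> laurent \<Rightarrow> laurent" where
  "subst_shift i s f =
     (\<Sum>k\<in>Poly_Mapping.keys f.
        Poly_Mapping.single (k - Poly_Mapping.single i (Poly_Mapping.lookup k i))
          (Poly_Mapping.lookup f k)
        * (var i - const s) ^ nat (Poly_Mapping.lookup k i))"

text \<open>$(a e^{-\partial_i})^m$ for an integer $m$; the inverse of $a e^{-\partial_i}$ is
  $a^{-1} e^{\partial_i}$, where $e^{\partial_i}$ is the substitution $t_i \mapsto t_i + 1$.\<close>

definition exp_shift_pow :: "complex \<Rightarrow> nat \<Rightarrow> int \<Rightarrow> laurent \<Rightarrow> laurent" where
  "exp_shift_pow a i m =
     (if m \<ge> 0 then (\<lambda>f. const a * subst_shift i 1 f) ^^ nat m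
      else (\<lambda>f. const (inverse a) * subst_shift i (- 1) f) ^^ nat (- m))"


section \<open>The modules $M_\omega$\<close>

text \<open>The symbol $\omega(f_1,\dots,f_{\mu-1}|a_\mu,\dots,a_\nu)$ is given by \<open>\<mu>\<close> and the functions
  \<open>f\<close> and \<open>a\<close>, of which only the values \<open>f j\<close> for \<open>1 \<le> j < \<mu>\<close> and \<open>a j\<close> for
  \<open>\<mu> \<le> j \<le> \<nu>\<close> matter.\<close>

definition omega_data :: "nat \<Rightarrow> nat \<Rightarrow> (nat \<Rightarrow> laurent) \<Rightarrow> (nat \<Rightarrow> complex) \<Rightarrow> bool" where
  "omega_data \<nu> \<mu> f a \<longleftrightarrow>
     1 \<le> \<mu> \<and> \<mu> \<le> \<nu> + 1 \<and>
     (\<forall>j\<in>{1..<\<mu>}. f j \<in> laurent_in {1..<\<mu>}) \<and>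
     (\<forall>j\<in>{\<mu>..\<nu>}. a j \<noteq> 0)"

fun gen_action ::
    "nat \<Rightarrow> nat \<Rightarrow> (nat \<Rightarrow> laurent) \<Rightarrow> (nat \<Rightarrow> complex) \<Rightarrow> generator \<Rightarrow> laurent \<Rightarrow> laurent" where
  "gen_action \<nu> \<mu> f a (E \<alpha>) h =
     (\<Prod>i\<in>{1..<\<mu>}. var_pow i (Poly_Mapping.lookup \<alpha> i)) *
     fold (\<lambda>i. exp_shift_pow (a i) i (Poly_Mapping.lookup \<alpha> i)) [\<mu>..<\<nu> + 1] h"
| "gen_action \<nu> \<mu> f a (D j) h =
     (if j < \<mu> then var j * partial j h + f j * h else var j * h)"

text \<open>Words act by composition (the leftmost letter acts last), and the action is extended
  linearly to the free algebra.\<close>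

definition free_action ::
    "nat \<Rightarrow> nat \<Rightarrow> (nat \<Rightarrow> laurent) \<Rightarrow> (nat \<Rightarrow> complex) \<Rightarrow> free_elt \<Rightarrow> laurent \<Rightarrow> laurent" where
  "free_action \<nu> \<mu> f a p h =
     (\<Sum>w\<in>Poly_Mapping.keys p.
        const (Poly_Mapping.lookup p w) * foldr (gen_action \<nu> \<mu> f a) (letters w) h)"

text \<open>Since $M_\omega$ is free of rank one on $\omega$, the element $h\,\omega$ is represented by
  the polynomial \<open>h\<close>.\<close>

definition M_free ::
    "nat \<Rightarrow> nat \<Rightarrow> (nat \<Rightarrow> laurent) \<Rightarrow> (nat \<Rightarrow> complex) \<Rightarrow> (free_elt, laurent) module" where
  "M_free \<nu> \<mu> f a =
     \<lparr>carrier = mixed_ring \<nu> \<mu>, mult = (*), one = 1, zero = 0, add = (+),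
      smult = free_action \<nu> \<mu> f a\<rparr>"

definition M_B ::
    "nat \<Rightarrow> nat \<Rightarrow> (nat \<Rightarrow> laurent) \<Rightarrow> (nat \<Rightarrow> complex) \<Rightarrow> (free_elt set, laurent) module" where
  "M_B \<nu> \<mu> f a = quotient_module (freeB \<nu>) (idealB \<nu>) (M_free \<nu> \<mu> f a)"

definition is_A_module :: "nat \<Rightarrow> nat \<Rightarrow> (nat \<Rightarrow> laurent) \<Rightarrow> (nat \<Rightarrow> complex) \<Rightarrow> bool" where
  "is_A_module \<nu> \<mu> f a \<longleftrightarrow> factors_through_quotient (algB \<nu>) (idealA \<nu>) (M_B \<nu> \<mu> f a)"

definition M_A ::
    "nat \<Rightarrow> nat \<Rightarrow> (nat \<Rightarrow> laurent) \<Rightarrow> (nat \<Rightarrow> complex) \<Rightarrow> (free_elt set set, laurent) module" where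
  "M_A \<nu> \<mu> f a = quotient_module (algB \<nu>) (idealA \<nu>) (M_B \<nu> \<mu> f a)"

end

theory Submission
  imports Defs
begin

text \<open>
  All modules involved are pulled back to the free algebra, where submodules and homomorphisms
  are the same. On \<open>M\<^sub>\<omega>\<close> the relations of \<open>B\<close> always hold, and \<open>d\<^sub>i\<close>, \<open>d\<^sub>j\<close> commute iff
  \<open>t\<^sub>i\<partial>\<^sub>i f\<^sub>j = t\<^sub>j\<partial>\<^sub>j f\<^sub>i\<close>; comparing coefficients, \<open>f\<^sub>j(k) / k\<^sub>j\<close> does not depend on \<open>j\<close>
  and is the coefficient at \<open>k \<noteq> 0\<close> of the potential \<open>P\<close>. Simplicity is automatic: a nonzero submodule
  is an ideal stable under \<open>t\<^sub>i\<partial>\<^sub>i\<close> (\<open>i < \<mu>\<close>) and \<open>t\<^sub>i \<mapsto> t\<^sub>i - 1\<close> (\<open>i \<ge> \<mu>\<close>), and such an ideal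
  contains \<open>1\<close>. An isomorphism sends \<open>1\<close> to some \<open>u \<noteq> 0\<close>. The operators \<open>e\<^sub>\<alpha>\<close> then
  give \<open>\<mu> = \<gamma>\<close> and \<open>a = b\<close>, and \<open>d\<^sub>j\<close> gives \<open>(f\<^sub>j - g\<^sub>j) u = t\<^sub>j\<partial>\<^sub>j u\<close>, which forces
  \<open>f\<^sub>j - g\<^sub>j\<close> to be an integer. Conversely, multiplication by a monomial realises integer differences.
\<close>

section \<open>Modules over quotient rings\<close>

text \<open>Nothing is ever computed inside \<open>algB\<close> or \<open>algA\<close>: an action
  factors through a quotient iff the ideal lies in the annihilator, and the annihilator is itself an
  ideal, so only generators of the ideal are tested. The condition on the f_j says that the
  logarithmic form with components f_j is closed. As \<open>theta j\<close> multiplies t^k by k_j, a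
  potential is found by division at each k \<noteq> 0. The only obstruction sits at k = 0, so the
  P_j can be taken constant; allowing them to depend on t_j adds nothing, because
  \<open>theta i\<close> kills P_j for i \<noteq> j. Multiplication by an element of the mixed ring
  is realised by one element of the free algebra, the same for all f and a. This turns submodules
  into ideals and, once \<mu> = \<gamma>, makes an isomorphism commute with multiplication by f_j.
  Euler operators are diagonal on monomials, the substitutions t_i - s are not. For the latter only
  the two leading layers in t_i are controlled: the top one is unchanged, the next one changes by -s
  times the derivative. That is enough both for simplicity and for a = b.\<close>

definition annihilator :: "('a, 'r) ring_scheme \<Rightarrow> ('a, 'b, 'm) module_scheme \<Rightarrow> 'a set" where
  "annihilator R M = {r \<in> carrier R. \<forall>x\<in>carrier M. r \<odot>\<^bsub>M\<^esub> x = \<zero>\<^bsub>M\<^esub>}"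

context left_module
begin

lemma l_zero_smult: "x \<in> carrier M \<Longrightarrow> \<zero>\<^bsub>R\<^esub> \<odot>\<^bsub>M\<^esub> x = \<zero>\<^bsub>M\<^esub>"
proof -
  assume x: "x \<in> carrier M"
  then have "\<zero>\<^bsub>R\<^esub> \<odot>\<^bsub>M\<^esub> x \<oplus>\<^bsub>M\<^esub> \<zero>\<^bsub>R\<^esub> \<odot>\<^bsub>M\<^esub> x = \<zero>\<^bsub>R\<^esub> \<odot>\<^bsub>M\<^esub> x"
    using smult_l_distr[of "\<zero>\<^bsub>R\<^esub>" "\<zero>\<^bsub>R\<^esub>" x] by simp
  with x show ?thesis
    using M.add.l_cancel_one smult_closed by blast
qed

lemma r_zero_smult: "r \<in> carrier R \<Longrightarrow> r \<odot>\<^bsub>M\<^esub> \<zero>\<^bsub>M\<^esub> = \<zero>\<^bsub>M\<^esub>"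
  using smult_r_distr[of r "\<zero>\<^bsub>M\<^esub>" "\<zero>\<^bsub>M\<^esub>"] M.add.l_cancel_one smult_closed
  by (metis M.l_zero M.zero_closed)

lemma l_minus_smult:
  "r \<in> carrier R \<Longrightarrow> x \<in> carrier M \<Longrightarrow> (\<ominus>\<^bsub>R\<^esub> r) \<odot>\<^bsub>M\<^esub> x = \<ominus>\<^bsub>M\<^esub> (r \<odot>\<^bsub>M\<^esub> x)"
  using smult_l_distr[of "\<ominus>\<^bsub>R\<^esub> r" r x] l_zero_smult[of x]
  by (metis M.minus_equality R.a_inv_closed R.l_neg smult_closed)

lemma smult_diff_eq_zero_iff:
  assumes "r \<in> carrier R" "s \<in> carrier R" "x \<in> carrier M"
  shows "(r \<ominus>\<^bsub>R\<^esub> s) \<odot>\<^bsub>M\<^esub> x = \<zero>\<^bsub>M\<^esub> \<longleftrightarrow> r \<odot>\<^bsub>M\<^esub> x = s \<odot>\<^bsub>M\<^esub> x"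
proof -
  have "(r \<ominus>\<^bsub>R\<^esub> s) \<odot>\<^bsub>M\<^esub> x = r \<odot>\<^bsub>M\<^esub> x \<ominus>\<^bsub>M\<^esub> s \<odot>\<^bsub>M\<^esub> x"
    using assms by (simp add: R.minus_eq M.minus_eq smult_l_distr l_minus_smult)
  then show ?thesis
    using smult_closed[OF assms(1,3)] smult_closed[OF assms(2,3)]
    by (metis M.a_inv_closed M.minus_eq M.minus_equality M.minus_minus M.r_neg)
qed

text \<open>An ideal given by generators lies in the annihilator as soon as its generators do, so
  relations can be checked one by one.\<close>

lemma annihilator_ideal: "ideal (annihilator R M) R"
proof (rule idealI)
  show "ring R" ..
  show "subgroup (annihilator R M) (add_monoid R)"
    by (rule R.add.subgroupI)
      (auto simp: annihilator_def l_zero_smult l_minus_smult smult_l_distr simp flip: a_inv_def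
            intro!: exI[of _ "\<zero>\<^bsub>R\<^esub>"])
qed (auto simp: annihilator_def smult_assoc1 r_zero_smult smult_closed)

end

lemma factors_through_quotient_iff:
  assumes "left_module R M" "ideal I R"
  shows "factors_through_quotient R I M \<longleftrightarrow> I \<subseteq> annihilator R M"
proof
  interpret left_module R M by fact
  interpret I: ideal I R by fact
  assume "factors_through_quotient R I M"
  then obtain act where
    act: "\<And>r x. r \<in> carrier R \<Longrightarrow> x \<in> carrier M \<Longrightarrow> act (I +>\<^bsub>R\<^esub> r) x = r \<odot>\<^bsub>M\<^esub> x"
    by (auto simp: factors_through_quotient_def is_induced_action_def)
  show "I \<subseteq> annihilator R M"
  proof
    fix r assume r: "r \<in> I"
    then have "I +>\<^bsub>R\<^esub> r = I +>\<^bsub>R\<^esub> \<zero>\<^bsub>R\<^esub>"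
      using R.a_rcos_zero[OF assms(2)] by simp
    then show "r \<in> annihilator R M"
      using act[of r] act[of "\<zero>\<^bsub>R\<^esub>"] I.Icarr[OF r] by (auto simp: annihilator_def l_zero_smult)
  qed
next
  interpret left_module R M by fact
  interpret I: ideal I R by fact
  assume sub: "I \<subseteq> annihilator R M"
  \<comment> \<open>Any representative of the coset will do: two of them differ by an element of
    \<open>I\<close>, which acts as zero.\<close>
  define act where "act = (\<lambda>C x. (SOME r. r \<in> C) \<odot>\<^bsub>M\<^esub> x)"
  have "act (I +>\<^bsub>R\<^esub> r) x = r \<odot>\<^bsub>M\<^esub> x" if r: "r \<in> carrier R" and x: "x \<in> carrier M" for r x
  proof -
    have "r \<in> I +>\<^bsub>R\<^esub> r"
      using I.a_rcos_self r by blast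
    then have "(SOME s. s \<in> I +>\<^bsub>R\<^esub> r) \<in> I +>\<^bsub>R\<^esub> r"
      by (rule someI)
    then obtain i where i: "i \<in> I" "(SOME s. s \<in> I +>\<^bsub>R\<^esub> r) = i \<oplus>\<^bsub>R\<^esub> r"
      by (auto simp: a_r_coset_def')
    have "i \<odot>\<^bsub>M\<^esub> x = \<zero>\<^bsub>M\<^esub>"
      using i sub x by (auto simp: annihilator_def)
    then show ?thesis
      using i r x I.Icarr by (simp add: act_def smult_l_distr smult_closed)
  qed
  then show "factors_through_quotient R I M"
    by (auto simp: factors_through_quotient_def is_induced_action_def)
qed

lemma quotient_module_simps [simp]:
  "carrier (quotient_module R I M) = carrier M"
  "zero (quotient_module R I M) = zero M"
  "add (quotient_module R I M) = add M"
  by (simp_all add: quotient_module_def)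

text \<open>The type of an additive monoid records the scalars, so the two monoids cannot be equated.\<close>

lemma subgroup_add_monoid_quotient_module:
  "subgroup N (add_monoid (quotient_module R I M)) \<longleftrightarrow> subgroup N (add_monoid M)"
  by (simp add: subgroup_def m_inv_def)

lemma abelian_group_quotient_module:
  assumes "abelian_group M"
  shows "abelian_group (quotient_module R I M)"
proof -
  interpret abelian_group M by fact
  show ?thesis
    by (rule abelian_groupI) (auto simp: a_ac intro: l_neg)
qed

lemma smult_quotient_module:
  assumes "factors_through_quotient R I M" "r \<in> carrier R" "x \<in> carrier M"
  shows "(I +>\<^bsub>R\<^esub> r) \<odot>\<^bsub>quotient_module R I M\<^esub> x = r \<odot>\<^bsub>M\<^esub> x"
proof -
  have "is_induced_action R I M (SOME act. is_induced_action R I M act)"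
    using assms(1) unfolding factors_through_quotient_def by (rule someI_ex)
  then show ?thesis
    using assms(2,3) by (simp add: is_induced_action_def quotient_module_def)
qed

lemma carrier_FactRing: "carrier (R Quot I) = (\<lambda>r. I +>\<^bsub>R\<^esub> r) ` carrier R"
  by (auto simp: FactRing_simps)

lemma left_module_quotient_module:
  assumes "left_module R M" "ideal I R" "factors_through_quotient R I M"
  shows "left_module (R Quot I) (quotient_module R I M)"
proof -
  interpret left_module R M by fact
  interpret I: ideal I R by fact
  interpret Q: ring "R Quot I" by (rule I.quotient_is_ring)
  interpret h: ring_hom_ring R "R Quot I" "(+>\<^bsub>R\<^esub>) I" by (rule I.rcos_ring_hom_ring)
  note sm = smult_quotient_module[OF assms(3)]
  interpret QM: abelian_group "quotient_module R I M"
    by (rule abelian_group_quotient_module) (rule M.abelian_group_axioms)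
  show ?thesis
    by unfold_locales
      (auto simp: carrier_FactRing sm smult_l_distr smult_r_distr smult_assoc1 smult_one smult_closed
      simp flip: h.hom_add h.hom_mult h.hom_one)
qed

text \<open>Every scalar of \<open>R Quot I\<close> is a coset of some scalar of \<open>R\<close>
  and acts like it, so both sides ask for stability under the same maps.\<close>

lemma submodule_quotient_module_iff:
  assumes "factors_through_quotient R I M"
  shows "submodule N (R Quot I) (quotient_module R I M) \<longleftrightarrow> submodule N R M"
proof -
  have "(\<forall>C\<in>carrier (R Quot I). \<forall>x\<in>N. C \<odot>\<^bsub>quotient_module R I M\<^esub> x \<in> N)
      \<longleftrightarrow> (\<forall>r\<in>carrier R. \<forall>x\<in>N. r \<odot>\<^bsub>M\<^esub> x \<in> N)" if "subgroup N (add_monoid M)"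
    \<comment> \<open>The induced action is specified on the carrier only, so \<open>N\<close> must
      first be known to lie there.\<close>
    using subgroup.subset[OF that]
    by (auto simp: carrier_FactRing smult_quotient_module[OF assms] subset_iff)
  then show ?thesis
    unfolding submodule_def submodule_axioms_def subgroup_add_monoid_quotient_module by blast
qed

lemma simple_module_quotient_module_iff:
  assumes "left_module R M" "ideal I R" "factors_through_quotient R I M"
  shows "simple_module (R Quot I) (quotient_module R I M) \<longleftrightarrow> simple_module R M"
  using assms left_module_quotient_module[OF assms] submodule_quotient_module_iff[OF assms(3)]
  by (simp add: simple_module_def)

lemma module_isomorphic_quotient_module_iff:
  assumes "factors_through_quotient R I M" "factors_through_quotient R I N"
  shows "module_isomorphic (R Quot I) (quotient_module R I M) (quotient_module R I N)
    \<longleftrightarrow> module_isomorphic R M N"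
proof -
  have "module_hom (R Quot I) (quotient_module R I M) (quotient_module R I N) = module_hom R M N"
    unfolding module_hom_def
    using smult_quotient_module[OF assms(1)] smult_quotient_module[OF assms(2)]
    by (simp add: carrier_FactRing) (intro Collect_cong, blast?, auto)
  then show ?thesis
    by (simp add: module_isomorphic_def)
qed

section \<open>Laurent polynomials\<close>

abbreviation "lookup \<equiv> Poly_Mapping.lookup"
abbreviation "keys \<equiv> Poly_Mapping.keys"
abbreviation "single \<equiv> Poly_Mapping.single"

lemma sum_monomials: "(\<Sum>k\<in>keys f. single k (lookup f k)) = f"
  by (rule poly_mapping_eqI)
    (auto simp: lookup_sum lookup_single when_def in_keys_iff)

text \<open>Restricting the monomial case to exponents of \<open>f\<close> makes a hypothesis about
  the support of \<open>f\<close> available there without building it into \<open>P\<close>.\<close>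

lemma poly_mapping_induct_keys [case_names zero single add]:
  fixes f :: "'a \<Rightarrow>\<^sub>0 'b::comm_monoid_add"
  assumes "P 0"
    and "\<And>k c. k \<in> keys f \<Longrightarrow> P (single k c)"
    and "\<And>g h. P g \<Longrightarrow> P h \<Longrightarrow> P (g + h)"
  shows "P f"
proof -
  have "P (\<Sum>k\<in>K. single k (lookup f k))" if "finite K" "K \<subseteq> keys f" for K
    using that by (induction K) (auto intro: assms)
  from this[of "keys f"] show ?thesis
    by (simp add: sum_monomials)
qed

lemma poly_mapping_induct [case_names zero single add]:
  fixes f :: "'a \<Rightarrow>\<^sub>0 'b::comm_monoid_add"
  assumes "P 0" and "\<And>k c. P (single k c)" and "\<And>g h. P g \<Longrightarrow> P h \<Longrightarrow> P (g + h)"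
  shows "P f"
  by (rule poly_mapping_induct_keys) (simp_all add: assms)

lemma sum_keys_single:
  "g k 0 = 0 \<Longrightarrow> (\<Sum>k'\<in>keys (single k c). g k' (lookup (single k c) k')) = g k c"
  by (cases "c = 0") auto

lemma const_simps [simp]:
  "const 0 = 0" "const 1 = 1"
  by (simp_all add: const_def)

lemma const_add: "const (c + d) = const c + const d"
  by (simp add: const_def single_add)

lemma const_mult: "const (c * d) = const c * const d"
  by (simp add: const_def mult_single)

lemma const_mult_single: "const c * single k d = single k (c * d)"
  by (simp add: const_def mult_single)

lemma lookup_const_mult: "lookup (const c * x) k = c * lookup x k"
  by (induction x rule: poly_mapping_induct)
    (simp_all add: const_mult_single lookup_single distrib_left lookup_add when_def)

lemma const_uminus: "const (- c) = - const c"
  by (simp add: const_def single_uminus)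

lemma const_of_int: "const (of_int n) = of_int n"
  by (simp add: const_def)

section \<open>Complex-linear operators on Laurent polynomials\<close>

definition clinear_op :: "(laurent \<Rightarrow> laurent) \<Rightarrow> bool" where
  "clinear_op T \<longleftrightarrow> (\<forall>x y. T (x + y) = T x + T y) \<and> (\<forall>c x. T (const c * x) = const c * T x)"

lemma clinear_opD:
  assumes "clinear_op T"
  shows "T (x + y) = T x + T y" "T (const c * x) = const c * T x" "T 0 = 0"
proof -
  show "T (x + y) = T x + T y" and *: "T (const c * x) = const c * T x" for c x y
    using assms by (auto simp: clinear_op_def)
  show "T 0 = 0"
    using *[of 0 0] by simp
qed

lemma clinear_op_id: "clinear_op (\<lambda>x. x)"
  by (simp add: clinear_op_def)

lemma clinear_op_add: "clinear_op S \<Longrightarrow> clinear_op T \<Longrightarrow> clinear_op (\<lambda>x. S x + T x)"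
  by (simp add: clinear_op_def algebra_simps)

lemma clinear_op_mult: "clinear_op T \<Longrightarrow> clinear_op (\<lambda>x. y * T x)"
  by (simp add: clinear_op_def algebra_simps)

lemma clinear_op_funpow: "clinear_op T \<Longrightarrow> clinear_op (T ^^ n)"
  by (induction n) (auto simp: clinear_op_def)

lemma clinear_op_fold: "(\<And>i. clinear_op (T i)) \<Longrightarrow> clinear_op (fold T l)"
  by (induction l) (auto simp: clinear_op_def)

lemma clinear_op_foldr: "(\<And>i. clinear_op (T i)) \<Longrightarrow> clinear_op (foldr T l)"
  by (induction l) (auto simp: clinear_op_def)

text \<open>All the rings in play are cut out by conditions on exponents; their closure properties
  are instances of those of this set.\<close>

definition supported_on :: "(nat \<Rightarrow>\<^sub>0 int) set \<Rightarrow> laurent set" where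
  "supported_on K = {x. keys x \<subseteq> K}"

lemma supported_on_iff: "x \<in> supported_on K \<longleftrightarrow> (\<forall>k. k \<notin> K \<longrightarrow> lookup x k = 0)"
  by (auto simp: supported_on_def in_keys_iff)

lemma supported_on_mono: "K \<subseteq> L \<Longrightarrow> supported_on K \<subseteq> supported_on L"
  by (auto simp: supported_on_def)

lemma supported_on_closed:
  "0 \<in> supported_on K"
  "x \<in> supported_on K \<Longrightarrow> y \<in> supported_on K \<Longrightarrow> x + y \<in> supported_on K"
  "x \<in> supported_on K \<Longrightarrow> - x \<in> supported_on K"
  "x \<in> supported_on K \<Longrightarrow> y \<in> supported_on K \<Longrightarrow> x - y \<in> supported_on K"
  by (simp_all add: supported_on_iff lookup_add lookup_minus)

lemma single_supported_on: "k \<in> K \<Longrightarrow> single k c \<in> supported_on K"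
  by (simp add: supported_on_def)

lemma const_mult_supported_on: "x \<in> supported_on K \<Longrightarrow> const c * x \<in> supported_on K"
  by (auto simp: supported_on_def in_keys_iff lookup_const_mult)

lemma mult_supported_on:
  assumes "\<And>k l. k \<in> K \<Longrightarrow> l \<in> K \<Longrightarrow> k + l \<in> K" "x \<in> supported_on K" "y \<in> supported_on K"
  shows "x * y \<in> supported_on K"
  using keys_mult[of x y] assms by (fastforce simp: supported_on_def)

definition mixed_exps :: "nat \<Rightarrow> nat \<Rightarrow> (nat \<Rightarrow>\<^sub>0 int) set" where
  "mixed_exps \<nu> \<mu> = {k. keys k \<subseteq> {1..\<nu>} \<and> (\<forall>i\<in>{\<mu>..\<nu>}. 0 \<le> lookup k i)}"

text \<open>These elements behave like constants for the operators attached to t_i, i in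
  \<open>X\<close>: \<open>theta i\<close> kills them and \<open>subst_shift i s\<close> is linear
  over them.\<close>

definition free_of :: "nat set \<Rightarrow> laurent set" where
  "free_of X = supported_on {k. \<forall>i\<in>X. lookup k i = 0}"

text \<open>The natural domain of the substitutions t_i - s: \<open>subst_shift\<close> passes
  exponents through \<open>nat\<close>, which loses the negative ones.\<close>

definition nonneg_in :: "nat \<Rightarrow> laurent set" where
  "nonneg_in i = supported_on {k. 0 \<le> lookup k i}"

lemma mixed_exps_iff:
  "k \<in> mixed_exps \<nu> \<mu> \<longleftrightarrow>
    (\<forall>i. i \<notin> {1..\<nu>} \<longrightarrow> lookup k i = 0) \<and> (\<forall>i\<in>{\<mu>..\<nu>}. 0 \<le> lookup k i)"
  by (auto simp: mixed_exps_def subset_iff in_keys_iff)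

lemma mixed_ring_eq: "mixed_ring \<nu> \<mu> = supported_on (mixed_exps \<nu> \<mu>)"
  by (auto simp: mixed_ring_def laurent_in_def supported_on_def mixed_exps_def)

lemma laurent_in_eq: "laurent_in X = supported_on {k. keys k \<subseteq> X}"
  by (auto simp: laurent_in_def supported_on_def)

lemma laurent_in_eq_free_of: "laurent_in X = free_of (- X)"
  by (auto simp: laurent_in_eq free_of_def supported_on_def subset_iff in_keys_iff)

lemmas mixed_ring_closed = supported_on_closed[where K = "mixed_exps \<nu> \<mu>" for \<nu> \<mu>, folded mixed_ring_eq]
lemmas free_of_closed = supported_on_closed[where K = "{k. \<forall>i\<in>X. lookup k i = 0}" for X, folded free_of_def]
lemmas nonneg_in_closed = supported_on_closed[where K = "{k. 0 \<le> lookup k i}" for i, folded nonneg_in_def]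

lemma mixed_ring_mult: "x \<in> mixed_ring \<nu> \<mu> \<Longrightarrow> y \<in> mixed_ring \<nu> \<mu> \<Longrightarrow> x * y \<in> mixed_ring \<nu> \<mu>"
  unfolding mixed_ring_eq
  by (rule mult_supported_on) (auto simp: mixed_exps_iff lookup_add)

lemma free_of_mult: "x \<in> free_of X \<Longrightarrow> y \<in> free_of X \<Longrightarrow> x * y \<in> free_of X"
  unfolding free_of_def by (rule mult_supported_on) (auto simp: lookup_add)

lemma nonneg_in_mult: "x \<in> nonneg_in i \<Longrightarrow> y \<in> nonneg_in i \<Longrightarrow> x * y \<in> nonneg_in i"
  unfolding nonneg_in_def by (rule mult_supported_on) (auto simp: lookup_add)

lemma const_mem: "const c \<in> mixed_ring \<nu> \<mu>" "const c \<in> free_of X" "const c \<in> nonneg_in i"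
  unfolding mixed_ring_eq free_of_def nonneg_in_def const_def
  by (rule single_supported_on; simp add: mixed_exps_def)+

lemma one_mem: "1 \<in> mixed_ring \<nu> \<mu>" "1 \<in> free_of X" "1 \<in> nonneg_in i"
  using const_mem[of 1] by simp_all

lemma free_of_power: "x \<in> free_of X \<Longrightarrow> x ^ n \<in> free_of X"
  by (induction n) (auto intro: free_of_mult one_mem)

lemma nonneg_in_power: "x \<in> nonneg_in i \<Longrightarrow> x ^ n \<in> nonneg_in i"
  by (induction n) (auto intro: nonneg_in_mult one_mem)

lemma mixed_ring_power: "x \<in> mixed_ring \<nu> \<mu> \<Longrightarrow> x ^ n \<in> mixed_ring \<nu> \<mu>"
  by (induction n) (auto intro: mixed_ring_mult one_mem)

lemma free_of_antimono: "X \<subseteq> Y \<Longrightarrow> x \<in> free_of Y \<Longrightarrow> x \<in> free_of X"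
  by (auto simp: free_of_def supported_on_def)

lemma mixed_ring_nonneg_in: "x \<in> mixed_ring \<nu> \<mu> \<Longrightarrow> i \<in> {\<mu>..\<nu>} \<Longrightarrow> x \<in> nonneg_in i"
  by (auto simp: mixed_ring_eq supported_on_def nonneg_in_def mixed_exps_def)

lemma laurent_in_mixed_ring:
  assumes "\<mu> \<le> \<nu> + 1" "x \<in> laurent_in {1..<\<mu>}"
  shows "x \<in> mixed_ring \<nu> \<mu>"
proof -
  have "{k :: nat \<Rightarrow>\<^sub>0 int. \<forall>i\<in>- {1..<\<mu>}. lookup k i = 0} \<subseteq> mixed_exps \<nu> \<mu>"
  proof
    fix k :: "nat \<Rightarrow>\<^sub>0 int" assume "k \<in> {k. \<forall>i\<in>- {1..<\<mu>}. lookup k i = 0}"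
    then have "lookup k i = 0" if "i < 1 \<or> \<mu> \<le> i" for i
      using that by auto
    then show "k \<in> mixed_exps \<nu> \<mu>"
      using assms(1) by (auto simp: mixed_exps_iff)
  qed
  then show ?thesis
    using assms(2) supported_on_mono
    unfolding laurent_in_eq_free_of free_of_def mixed_ring_eq by blast
qed

lemma var_pow_free_of: "i \<notin> X \<Longrightarrow> var_pow i m \<in> free_of X"
  unfolding var_pow_def free_of_def
  by (rule single_supported_on) (auto simp: lookup_single when_def)

lemma var_nonneg_in: "var i \<in> nonneg_in j"
  unfolding var_pow_def nonneg_in_def
  by (rule single_supported_on) (auto simp: lookup_single when_def)

lemma var_pow_mixed_ring: "i \<in> {1..\<nu>} \<Longrightarrow> i < \<mu> \<or> 0 \<le> m \<Longrightarrow> var_pow i m \<in> mixed_ring \<nu> \<mu>"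
  unfolding var_pow_def mixed_ring_eq mixed_exps_def
  by (rule single_supported_on) (auto simp: lookup_single when_def)

lemma var_pow_add: "var_pow i (m + n) = var_pow i m * var_pow i n"
  by (simp add: var_pow_def mult_single single_add)

lemma var_pow_0 [simp]: "var_pow i 0 = 1"
  by (simp add: var_pow_def)

lemma var_power: "var i ^ n = var_pow i (int n)"
  by (induction n) (simp_all add: var_pow_add)

lemma lookup_sum_single:
  "finite I \<Longrightarrow> lookup (\<Sum>i\<in>I. single i (m i)) j = (if j \<in> I then m j else 0)"
  by (simp add: lookup_sum lookup_single when_def)

lemma prod_var_pow: "finite I \<Longrightarrow> (\<Prod>i\<in>I. var_pow i (m i)) = single (\<Sum>i\<in>I. single i (m i)) 1"
  by (induction I rule: finite_induct) (simp_all add: var_pow_def mult_single)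

subsection \<open>The Euler operators\<close>

text \<open>The Euler operator. Unlike \<open>partial\<close> it is diagonal on monomials, which
  turns differential identities into identities between coefficients.\<close>

definition theta :: "nat \<Rightarrow> laurent \<Rightarrow> laurent" where
  "theta i x = var i * partial i x"

lemma partial_single: "partial j (single k c) = single (k - single j 1) (of_int (lookup k j) * c)"
  unfolding partial_def
  by (rule sum_keys_single[where g = "\<lambda>k c. single (k - single j 1) (of_int (lookup k j) * c)"]) simp

lemma partial_add: "partial j (x + y) = partial j x + partial j y"
  unfolding partial_def
  by (rule setsum_keys_plus_distrib) (simp_all add: distrib_left single_add)

lemma theta_single: "theta i (single k c) = single k (of_int (lookup k i) * c)"
  by (simp add: theta_def partial_single var_pow_def mult_single)

lemma theta_add: "theta i (x + y) = theta i x + theta i y"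
  by (simp add: theta_def partial_add distrib_left)

lemma theta_0 [simp]: "theta i 0 = 0"
  by (simp add: theta_def partial_def)

lemma lookup_theta: "lookup (theta i x) k = of_int (lookup k i) * lookup x k"
  by (induction x rule: poly_mapping_induct)
    (auto simp: theta_single theta_add lookup_add distrib_left lookup_single when_def)

lemma clinear_op_theta: "clinear_op (theta i)"
  unfolding clinear_op_def
  by (auto simp: theta_add intro!: poly_mapping_eqI simp: lookup_theta lookup_const_mult)

lemma theta_mult: "theta i (x * y) = theta i x * y + x * theta i y"
proof (induction x rule: poly_mapping_induct)
  case (single k c)
  show ?case
    by (induction y rule: poly_mapping_induct)
      (simp_all add: theta_single theta_add mult_single lookup_add algebra_simps single_add)
qed (simp_all add: theta_add algebra_simps)

lemma theta_supported_on: "x \<in> supported_on K \<Longrightarrow> theta i x \<in> supported_on K"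
  by (auto simp: supported_on_def in_keys_iff lookup_theta)

lemma theta_mixed_ring: "x \<in> mixed_ring \<nu> \<mu> \<Longrightarrow> theta i x \<in> mixed_ring \<nu> \<mu>"
  by (simp add: mixed_ring_eq theta_supported_on)

lemma theta_free_of: "x \<in> free_of {i} \<Longrightarrow> theta i x = 0"
  by (intro poly_mapping_eqI)
    (auto simp: lookup_theta free_of_def supported_on_def in_keys_iff)

subsection \<open>Shifts of variables\<close>

lemma subst_shift_single:
  "subst_shift i s (single k c) =
    single (k - single i (lookup k i)) c * (var i - const s) ^ nat (lookup k i)"
  unfolding subst_shift_def
  by (rule sum_keys_single[where g = "\<lambda>k c. single (k - single i (lookup k i)) c *
    (var i - const s) ^ nat (lookup k i)"]) simp

lemma subst_shift_add: "subst_shift i s (x + y) = subst_shift i s x + subst_shift i s y"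
  unfolding subst_shift_def
  by (rule setsum_keys_plus_distrib[where f = "\<lambda>k c. single (k - single i (lookup k i)) c *
    (var i - const s) ^ nat (lookup k i)"]) (simp_all add: single_add distrib_right)

lemma subst_shift_0 [simp]: "subst_shift i s 0 = 0"
  by (simp add: subst_shift_def)

text \<open>No sign condition on \<open>y\<close> is imposed: multiplying by \<open>x\<close> leaves
  the exponents of t_i in \<open>y\<close> as they are.\<close>

lemma subst_shift_free_of_mult:
  assumes "x \<in> free_of {i}"
  shows "subst_shift i s (x * y) = x * subst_shift i s y"
proof (induction x rule: poly_mapping_induct_keys)
  case (single k c)
  then have k: "lookup k i = 0"
    using assms by (auto simp: free_of_def supported_on_def)
  show ?case
  proof (induction y rule: poly_mapping_induct)
    case (single l d)
    show ?case
      by (simp add: subst_shift_single mult_single lookup_add k add_diff_eq flip: mult.assoc)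
  qed (simp_all add: subst_shift_add algebra_simps)
next
  case (add g h)
  then show ?case by (simp add: subst_shift_add algebra_simps)
qed simp

lemma clinear_op_subst_shift: "clinear_op (subst_shift i s)"
  unfolding clinear_op_def
  by (auto simp: subst_shift_add subst_shift_free_of_mult const_mem)

lemma subst_shift_free_of: "x \<in> free_of {i} \<Longrightarrow> subst_shift i s x = x"
proof -
  have "subst_shift i s 1 = 1"
    using subst_shift_single[of i s 0 1] by simp
  then show "x \<in> free_of {i} \<Longrightarrow> subst_shift i s x = x"
    using subst_shift_free_of_mult[of x i s 1] by simp
qed

text \<open>The sign conditions matter: \<open>nat\<close> is additive on nonnegative integers only.
  For instance t_i and its inverse have product 1, but are sent to t_i - s and 1.\<close>

lemma subst_shift_mult:
  assumes "x \<in> nonneg_in i" "y \<in> nonneg_in i"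
  shows "subst_shift i s (x * y) = subst_shift i s x * subst_shift i s y"
proof (induction x rule: poly_mapping_induct_keys)
  case (single k c)
  then have k: "0 \<le> lookup k i"
    using assms(1) by (auto simp: nonneg_in_def supported_on_def)
  show ?case
  proof (induction y rule: poly_mapping_induct_keys)
    case (single l d)
    then have l: "0 \<le> lookup l i"
      using assms(2) by (auto simp: nonneg_in_def supported_on_def)
    have "k + l - single i (lookup k i + lookup l i)
        = (k - single i (lookup k i)) + (l - single i (lookup l i))"
      by (simp add: single_add)
    then show ?case
      using k l
      by (simp add: subst_shift_single mult_single lookup_add nat_add_distrib power_add)
        (simp add: algebra_simps flip: mult_single)
  qed (simp_all add: subst_shift_add algebra_simps)
qed (simp_all add: subst_shift_add algebra_simps)

lemma subst_shift_var: "subst_shift i s (var i) = var i - const s"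
  using subst_shift_single[of i s "single i 1" 1] by (simp add: var_pow_def)

lemma subst_shift_power: "x \<in> nonneg_in i \<Longrightarrow> subst_shift i s (x ^ n) = subst_shift i s x ^ n"
  by (induction n) (simp_all add: subst_shift_mult nonneg_in_power subst_shift_free_of one_mem)

lemma subst_shift_diff: "subst_shift i s (x - y) = subst_shift i s x - subst_shift i s y"
  using subst_shift_add[of i s "x - y" y] by simp

lemma single_remove_free_of: "single (k - single i (lookup k i)) c \<in> free_of {i}"
  unfolding free_of_def by (rule single_supported_on) (simp add: lookup_minus)

lemma var_diff_const_nonneg_in: "var i - const s \<in> nonneg_in j"
  by (intro nonneg_in_closed var_nonneg_in const_mem)

lemma single_decompose:
  assumes "0 \<le> lookup k i"
  shows "single (k - single i (lookup k i)) c * var i ^ nat (lookup k i) = single k c"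
  using assms unfolding var_power by (simp add: var_pow_def mult_single)

text \<open>Group law of the shifts: the part of a monomial without t_i passes through, and t_i - r
  becomes t_i - (s + r).\<close>

lemma subst_shift_subst_shift:
  assumes "x \<in> nonneg_in i"
  shows "subst_shift i s (subst_shift i r x) = subst_shift i (s + r) x"
proof (induction x rule: poly_mapping_induct_keys)
  case (single k c)
  have "subst_shift i s (var i - const r) = var i - const (s + r)"
    by (simp add: subst_shift_diff subst_shift_var subst_shift_free_of const_mem const_add)
  then show ?case
    by (simp add: subst_shift_single subst_shift_free_of_mult single_remove_free_of
      subst_shift_power var_diff_const_nonneg_in)
qed (simp_all add: subst_shift_add)

text \<open>Even the zero shift is the identity only for nonnegative exponents, since a negative
  power of t_i is replaced by 1.\<close>

lemma subst_shift_zero_shift: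
  assumes "x \<in> nonneg_in i"
  shows "subst_shift i 0 x = x"
proof (induction x rule: poly_mapping_induct_keys)
  case (single k c)
  then have "0 \<le> lookup k i"
    using assms by (auto simp: nonneg_in_def supported_on_def)
  then show ?case
    by (simp add: subst_shift_single single_decompose)
qed (simp_all add: subst_shift_add)

lemma subst_shift_commute:
  assumes "i \<noteq> j"
  shows "subst_shift i s (subst_shift j r x) = subst_shift j r (subst_shift i s x)"
proof (induction x rule: poly_mapping_induct)
  case (single k c)
  \<comment> \<open>The monomial with both variables removed; each composite equals \<open>y\<close>
    times the two shifted powers.\<close>
  define y where "y = single (k - single i (lookup k i) - single j (lookup k j)) c"
  have 1: "subst_shift i s (single (k - single j (lookup k j)) c)
      = y * (var i - const s) ^ nat (lookup k i)"
    and 2: "subst_shift j r (single (k - single i (lookup k i)) c)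
      = y * (var j - const r) ^ nat (lookup k j)"
    using assms by (simp_all add: subst_shift_single y_def lookup_minus lookup_single
        diff_diff_eq add.commute)
  have "(var j - const r) ^ n \<in> free_of {i}" "(var i - const s) ^ n \<in> free_of {j}" for n
    using assms by (auto intro!: free_of_power free_of_closed var_pow_free_of const_mem)
  then have "subst_shift i s (subst_shift j r (single k c))
        = (var j - const r) ^ nat (lookup k j) * subst_shift i s (single (k - single j (lookup k j)) c)"
      "subst_shift j r (subst_shift i s (single k c))
        = (var i - const s) ^ nat (lookup k i) * subst_shift j r (single (k - single i (lookup k i)) c)"
    by (simp_all only: subst_shift_single[of i s k] subst_shift_single[of j r k]
        mult.commute[of "single _ _"] subst_shift_free_of_mult)
  then show ?case
    by (simp only: 1 2 mult_ac)
qed (simp_all add: subst_shift_add)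

text \<open>The power of t_i - s is free of t_j, hence killed by \<open>theta j\<close>, and
  removing t_i from a monomial keeps the exponent of t_j.\<close>

lemma theta_subst_shift:
  assumes "j \<noteq> i"
  shows "theta j (subst_shift i s x) = subst_shift i s (theta j x)"
proof (induction x rule: poly_mapping_induct)
  case (single k c)
  have "(var i - const s) ^ nat (lookup k i) \<in> free_of {j}"
    using assms by (intro free_of_power free_of_closed var_pow_free_of const_mem) auto
  then show ?case
    using assms by (simp add: subst_shift_single theta_single theta_mult theta_free_of
        lookup_minus lookup_single)
qed (simp_all add: subst_shift_add theta_add)

lemma subst_shift_nonneg_in:
  assumes "x \<in> nonneg_in j"
  shows "subst_shift i s x \<in> nonneg_in j"
proof (induction x rule: poly_mapping_induct_keys)
  case (single k c)
  have "single (k - single i (lookup k i)) c \<in> nonneg_in j"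
    unfolding nonneg_in_def
    by (rule single_supported_on)
      (use single assms in \<open>auto simp: nonneg_in_def supported_on_def lookup_minus lookup_single when_def\<close>)
  then show ?case
    by (simp add: subst_shift_single nonneg_in_mult nonneg_in_power var_diff_const_nonneg_in)
qed (simp_all add: subst_shift_add nonneg_in_closed)

lemma subst_shift_mixed_ring:
  assumes "x \<in> mixed_ring \<nu> \<mu>" "i \<in> {1..\<nu>}"
  shows "subst_shift i s x \<in> mixed_ring \<nu> \<mu>"
proof (induction x rule: poly_mapping_induct_keys)
  case (single k c)
  then have k: "k \<in> mixed_exps \<nu> \<mu>"
    using assms by (auto simp: mixed_ring_eq supported_on_def)
  have "single (k - single i (lookup k i)) c \<in> mixed_ring \<nu> \<mu>"
    unfolding mixed_ring_eq
    by (rule single_supported_on) (use k assms(2) in \<open>auto simp: mixed_exps_iff lookup_minus lookup_single when_def\<close>)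
  then show ?case
    using assms(2)
    by (simp add: subst_shift_single mixed_ring_mult mixed_ring_power mixed_ring_closed
        var_pow_mixed_ring const_mem)
qed (simp_all add: subst_shift_add mixed_ring_closed)

section \<open>Integer powers of the scaled shifts\<close>

lemma clinear_op_exp_shift_pow: "clinear_op (exp_shift_pow a i m)"
  unfolding exp_shift_pow_def
  by (simp add: clinear_op_funpow clinear_op_mult clinear_op_subst_shift)

lemma exp_shift_pow_eq:
  assumes "a \<noteq> 0" "x \<in> nonneg_in i"
  shows "exp_shift_pow a i m x = const (a powi m) * subst_shift i (of_int m) x"
proof -
  \<comment> \<open>One formula for both signs of \<open>m\<close>: it is used with
    \<open>b = a\<close>, \<open>s = 1\<close> and with \<open>b = inverse a\<close>,
    \<open>s = -1\<close>.\<close>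
  have *: "((\<lambda>f. const b * subst_shift i s f) ^^ n) x
      = const (b ^ n) * subst_shift i (of_nat n * s) x" for b s n
  proof (induction n)
    case 0
    show ?case using assms(2) by (simp add: subst_shift_zero_shift)
  next
    case (Suc n)
    then show ?case
      using assms(2)
      by (simp add: subst_shift_free_of_mult const_mem subst_shift_subst_shift const_mult
          distrib_right mult.assoc)
  qed
  show ?thesis
    using assms by (auto simp: exp_shift_pow_def * power_int_def)
qed

lemma exp_shift_pow_0 [simp]: "exp_shift_pow a i 0 = (\<lambda>x. x)"
  by (auto simp: exp_shift_pow_def)

lemma exp_shift_pow_mixed_ring:
  assumes "a \<noteq> 0" "x \<in> mixed_ring \<nu> \<mu>" "i \<in> {\<mu>..\<nu>}" "1 \<le> \<mu>"
  shows "exp_shift_pow a i m x \<in> mixed_ring \<nu> \<mu>"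
  using assms mixed_ring_nonneg_in[OF assms(2,3)]
  by (simp add: exp_shift_pow_eq mixed_ring_mult const_mem subst_shift_mixed_ring)

lemma exp_shift_pow_add:
  assumes "a \<noteq> 0" "x \<in> nonneg_in i"
  shows "exp_shift_pow a i m (exp_shift_pow a i n x) = exp_shift_pow a i (m + n) x"
  using assms
  by (simp add: exp_shift_pow_eq clinear_opD[OF clinear_op_exp_shift_pow] subst_shift_nonneg_in
      subst_shift_subst_shift power_int_add const_mult mult_ac)

lemma exp_shift_pow_commute:
  assumes "a \<noteq> 0" "b \<noteq> 0" "i \<noteq> j" "x \<in> nonneg_in i" "x \<in> nonneg_in j"
  shows "exp_shift_pow a i m (exp_shift_pow b j n x) = exp_shift_pow b j n (exp_shift_pow a i m x)"
  using assms
  by (simp add: exp_shift_pow_eq clinear_opD[OF clinear_op_exp_shift_pow] subst_shift_nonneg_in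
      subst_shift_commute mult_ac)

text \<open>Proved on the iterates, because the closed form would require \<open>y\<close> to lie in
  \<open>nonneg_in i\<close>.\<close>

lemma exp_shift_pow_free_of_mult:
  assumes "x \<in> free_of {i}"
  shows "exp_shift_pow a i m (x * y) = x * exp_shift_pow a i m y"
proof -
  have "((\<lambda>f. const b * subst_shift i s f) ^^ n) (x * y)
      = x * ((\<lambda>f. const b * subst_shift i s f) ^^ n) y" for b s n
    by (induction n) (simp_all add: subst_shift_free_of_mult assms mult_ac)
  then show ?thesis
    by (simp add: exp_shift_pow_def)
qed

text \<open>The source of the commutator of d_i and e_\<alpha> in the polynomial variables, where
  d_i is multiplication by t_i.\<close>

lemma exp_shift_pow_var_mult:
  assumes "a \<noteq> 0" "x \<in> nonneg_in i"
  shows "exp_shift_pow a i m (var i * x) = (var i - of_int m) * exp_shift_pow a i m x"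
  using assms
  by (simp add: exp_shift_pow_eq nonneg_in_mult var_nonneg_in subst_shift_mult subst_shift_var
      const_of_int mult_ac)

lemma theta_exp_shift_pow:
  assumes "j \<noteq> i"
  shows "theta j (exp_shift_pow a i m x) = exp_shift_pow a i m (theta j x)"
proof -
  have "theta j (((\<lambda>f. const b * subst_shift i s f) ^^ n) x)
      = ((\<lambda>f. const b * subst_shift i s f) ^^ n) (theta j x)" for b s n
    by (induction n) (simp_all add: clinear_opD[OF clinear_op_theta] theta_subst_shift assms)
  then show ?thesis
    by (simp add: exp_shift_pow_def)
qed

text \<open>The polynomial half of e_\<alpha>. The list of indices is kept arbitrary so that the
  facts below can be proved by induction on it.\<close>

definition fold_shift :: "(nat \<Rightarrow> complex) \<Rightarrow> lattice \<Rightarrow> nat list \<Rightarrow> laurent \<Rightarrow> laurent" where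
  "fold_shift a \<alpha> = fold (\<lambda>i. exp_shift_pow (a i) i (lookup \<alpha> i))"

lemma fold_shift_simps [simp]:
  "fold_shift a \<alpha> [] x = x"
  "fold_shift a \<alpha> (i # l) x = fold_shift a \<alpha> l (exp_shift_pow (a i) i (lookup \<alpha> i) x)"
  by (simp_all add: fold_shift_def)

lemma clinear_op_fold_shift: "clinear_op (fold_shift a \<alpha> l)"
  unfolding fold_shift_def by (intro clinear_op_fold clinear_op_exp_shift_pow)

lemma fold_shift_free_of_mult:
  "x \<in> free_of (set l) \<Longrightarrow> fold_shift a \<alpha> l (x * y) = x * fold_shift a \<alpha> l y"
proof (induction l arbitrary: y)
  case (Cons i l)
  then have "x \<in> free_of {i}" "x \<in> free_of (set l)"
    by (auto elim: free_of_antimono[rotated])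
  then show ?case
    by (simp add: exp_shift_pow_free_of_mult Cons.IH)
qed simp

lemma theta_fold_shift:
  "j \<notin> set l \<Longrightarrow> theta j (fold_shift a \<alpha> l x) = fold_shift a \<alpha> l (theta j x)"
  by (induction l arbitrary: x) (simp_all add: theta_exp_shift_pow)

lemma fold_shift_eq_id: "\<forall>i\<in>set l. lookup \<alpha> i = 0 \<Longrightarrow> fold_shift a \<alpha> l x = x"
  by (induction l arbitrary: x) simp_all

lemma fold_shift_cong: "\<forall>i\<in>set l. a i = b i \<Longrightarrow> fold_shift a \<alpha> l x = fold_shift b \<alpha> l x"
  by (induction l arbitrary: x) simp_all

context
  fixes \<nu> \<mu> :: nat and a :: "nat \<Rightarrow> complex"
  assumes \<mu>: "1 \<le> \<mu>" and a: "\<forall>i\<in>{\<mu>..\<nu>}. a i \<noteq> 0"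
begin

lemma fold_shift_mixed_ring:
  "set l \<subseteq> {\<mu>..\<nu>} \<Longrightarrow> x \<in> mixed_ring \<nu> \<mu> \<Longrightarrow> fold_shift a \<alpha> l x \<in> mixed_ring \<nu> \<mu>"
  by (induction l arbitrary: x) (use \<mu> a exp_shift_pow_mixed_ring in auto)

lemma fold_shift_exp_shift_pow:
  "set l \<subseteq> {\<mu>..\<nu>} \<Longrightarrow> i \<in> {\<mu>..\<nu>} - set l \<Longrightarrow> x \<in> mixed_ring \<nu> \<mu> \<Longrightarrow>
    fold_shift a \<alpha> l (exp_shift_pow (a i) i m x) = exp_shift_pow (a i) i m (fold_shift a \<alpha> l x)"
proof (induction l arbitrary: x)
  case (Cons j l)
  have "exp_shift_pow (a j) j (lookup \<alpha> j) (exp_shift_pow (a i) i m x)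
      = exp_shift_pow (a i) i m (exp_shift_pow (a j) j (lookup \<alpha> j) x)"
    using Cons.prems a mixed_ring_nonneg_in[OF Cons.prems(3)]
    by (intro exp_shift_pow_commute) auto
  then show ?case
    using Cons \<mu> a by (simp add: exp_shift_pow_mixed_ring)
qed simp

lemma fold_shift_fold_shift:
  "set l \<subseteq> {\<mu>..\<nu>} \<Longrightarrow> distinct l \<Longrightarrow> x \<in> mixed_ring \<nu> \<mu> \<Longrightarrow>
    fold_shift a \<alpha> l (fold_shift a \<beta> l x) = fold_shift a (\<alpha> + \<beta>) l x"
proof (induction l arbitrary: x)
  case (Cons i l)
  let ?T = "\<lambda>\<alpha>. exp_shift_pow (a i) i (lookup \<alpha> i)"
  have [simp]: "exp_shift_pow (a i) i m y \<in> mixed_ring \<nu> \<mu>" if "y \<in> mixed_ring \<nu> \<mu>" for m y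
    using Cons.prems \<mu> a that by (simp add: exp_shift_pow_mixed_ring)
  \<comment> \<open>The outer shift in t_i is moved inwards past the shifts of the tail, which
    concern other variables because the list is distinct; there it meets the inner shift in
    t_i.\<close>
  have "fold_shift a \<alpha> l (?T \<alpha> (fold_shift a \<beta> l (?T \<beta> x)))
      = fold_shift a \<alpha> l (fold_shift a \<beta> l (?T \<alpha> (?T \<beta> x)))"
    using Cons.prems by (subst fold_shift_exp_shift_pow[symmetric]) auto
  also have "\<dots> = fold_shift a (\<alpha> + \<beta>) l (?T (\<alpha> + \<beta>) x)"
    using Cons a mixed_ring_nonneg_in[OF Cons.prems(3), of i]
    by (simp add: exp_shift_pow_add lookup_add)
  finally show ?case by simp
qed simp

lemma fold_shift_var_mult:
  "set l \<subseteq> {\<mu>..\<nu>} \<Longrightarrow> distinct l \<Longrightarrow> x \<in> mixed_ring \<nu> \<mu> \<Longrightarrow> i \<in> set l \<Longrightarrow>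
    fold_shift a \<alpha> l (var i * x) = (var i - of_int (lookup \<alpha> i)) * fold_shift a \<alpha> l x"
proof (induction l arbitrary: x)
  case (Cons j l)
  show ?case
  proof (cases "j = i")
    case True
    then have "i \<notin> set l"
      using Cons.prems by simp
    \<comment> \<open>The factor produced by the shift in t_i involves none of the remaining
      variables, so the remaining shifts leave it alone.\<close>
    then have "var i - of_int (lookup \<alpha> i) \<in> free_of (set l)"
      by (auto intro!: free_of_closed var_pow_free_of const_mem simp flip: const_of_int)
    then show ?thesis
      using True Cons.prems a mixed_ring_nonneg_in[OF Cons.prems(3), of i]
      by (simp add: exp_shift_pow_var_mult fold_shift_free_of_mult)
  next
    case False
    then show ?thesis
      using Cons \<mu> a
      by (simp add: exp_shift_pow_free_of_mult var_pow_free_of exp_shift_pow_mixed_ring)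
  qed
qed simp

end

section \<open>The action of the free algebra\<close>

lemma free_algebra_simps [simp]:
  "mult (free_algebra X) = (*)" "one (free_algebra X) = 1"
  "zero (free_algebra X) = 0" "add (free_algebra X) = (+)"
  by (simp_all add: free_algebra_def)

lemma carrier_free_algebra:
  "p \<in> carrier (free_algebra X) \<longleftrightarrow> (\<forall>w. \<not> set (letters w) \<subseteq> X \<longrightarrow> lookup p w = 0)"
  by (auto simp: free_algebra_def in_keys_iff)

lemma carrier_free_algebra_closed:
  "0 \<in> carrier (free_algebra X)" "1 \<in> carrier (free_algebra X)"
  "p \<in> carrier (free_algebra X) \<Longrightarrow> - p \<in> carrier (free_algebra X)"
  "p \<in> carrier (free_algebra X) \<Longrightarrow> q \<in> carrier (free_algebra X) \<Longrightarrow> p + q \<in> carrier (free_algebra X)"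
  "p \<in> carrier (free_algebra X) \<Longrightarrow> q \<in> carrier (free_algebra X) \<Longrightarrow> p - q \<in> carrier (free_algebra X)"
  "single 0 c \<in> carrier (free_algebra X)"
  "x \<in> X \<Longrightarrow> gen x \<in> carrier (free_algebra X)"
  by (auto simp: carrier_free_algebra lookup_add lookup_minus lookup_one lookup_single
      zero_free_mon_def gen_def when_def)

lemma carrier_free_algebra_mult:
  assumes "p \<in> carrier (free_algebra X)" "q \<in> carrier (free_algebra X)"
  shows "p * q \<in> carrier (free_algebra X)"
proof -
  have "set (letters w) \<subseteq> X" if w: "w \<in> keys (p * q)" for w
  proof -
    obtain u v where "w = u + v" "u \<in> keys p" "v \<in> keys q"
      using keys_mult[of p q] w by blast
    then show ?thesis
      using assms by (auto simp: free_algebra_def plus_free_mon_def)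
  qed
  then show ?thesis
    by (simp add: free_algebra_def)
qed

lemma ring_free_algebra: "ring (free_algebra X)"
proof (rule ringI)
  show "abelian_group (free_algebra X)"
    by (rule abelian_groupI)
      (auto simp: add_ac carrier_free_algebra_closed intro: bexI[of _ "- p" for p])
  show "monoid (free_algebra X)"
    by (rule monoidI) (auto simp: mult.assoc carrier_free_algebra_mult carrier_free_algebra_closed)
qed (auto simp: algebra_simps)

section \<open>Action of generators, words and the free algebra\<close>

lemma gen_action_E:
  "gen_action \<nu> \<mu> f a (E \<alpha>) h =
    (\<Prod>i\<in>{1..<\<mu>}. var_pow i (lookup \<alpha> i)) * fold_shift a \<alpha> [\<mu>..<\<nu> + 1] h"
  by (simp add: fold_shift_def)

lemma gen_action_D:
  "gen_action \<nu> \<mu> f a (D j) h = (if j < \<mu> then theta j h + f j * h else var j * h)"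
  by (simp add: theta_def)

declare gen_action.simps [simp del]

lemma clinear_op_gen_action: "clinear_op (gen_action \<nu> \<mu> f a x)"
proof (cases x)
  case (E \<alpha>)
  then have "gen_action \<nu> \<mu> f a x = (\<lambda>h. (\<Prod>i\<in>{1..<\<mu>}. var_pow i (lookup \<alpha> i))
      * fold_shift a \<alpha> [\<mu>..<\<nu> + 1] h)"
    using gen_action_E by blast
  then show ?thesis
    by (simp only: clinear_op_mult clinear_op_fold_shift)
next
  case (D j)
  then have "gen_action \<nu> \<mu> f a x
      = (if j < \<mu> then (\<lambda>h. theta j h + f j * h) else (\<lambda>h. var j * h))"
    by (auto simp: gen_action_D)
  then show ?thesis
    by (simp add: clinear_op_mult clinear_op_add clinear_op_theta clinear_op_id)
qed

definition word_action ::
    "nat \<Rightarrow> nat \<Rightarrow> (nat \<Rightarrow> laurent) \<Rightarrow> (nat \<Rightarrow> complex) \<Rightarrow> generator free_mon \<Rightarrow> laurent \<Rightarrow> laurent" where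
  "word_action \<nu> \<mu> f a w = foldr (gen_action \<nu> \<mu> f a) (letters w)"

lemma clinear_op_word_action: "clinear_op (word_action \<nu> \<mu> f a w)"
  unfolding word_action_def by (intro clinear_op_foldr clinear_op_gen_action)

lemma word_action_add: "word_action \<nu> \<mu> f a (u + v) h = word_action \<nu> \<mu> f a u (word_action \<nu> \<mu> f a v h)"
  by (simp add: word_action_def plus_free_mon_def)

lemma free_action_single: "free_action \<nu> \<mu> f a (single w c) h = const c * word_action \<nu> \<mu> f a w h"
  unfolding free_action_def word_action_def
  by (rule sum_keys_single[where g = "\<lambda>w c. const c * foldr (gen_action \<nu> \<mu> f a) (letters w) h"]) simp

lemma free_action_add:
  "free_action \<nu> \<mu> f a (p + q) h = free_action \<nu> \<mu> f a p h + free_action \<nu> \<mu> f a q h"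
  unfolding free_action_def
  by (rule setsum_keys_plus_distrib) (simp_all add: const_add algebra_simps)

lemma free_action_0 [simp]: "free_action \<nu> \<mu> f a 0 h = 0"
  by (simp add: free_action_def)

lemma free_action_diff:
  "free_action \<nu> \<mu> f a (p - q) h = free_action \<nu> \<mu> f a p h - free_action \<nu> \<mu> f a q h"
  using free_action_add[of \<nu> \<mu> f a "p - q" q h] by simp

lemma clinear_op_free_action: "clinear_op (free_action \<nu> \<mu> f a p)"
proof (induction p rule: poly_mapping_induct)
  case (single w c)
  have "free_action \<nu> \<mu> f a (single w c) = (\<lambda>h. const c * word_action \<nu> \<mu> f a w h)"
    by (auto simp: free_action_single)
  then show ?case
    by (simp add: clinear_op_mult clinear_op_word_action)
next
  case (add p q)
  have "free_action \<nu> \<mu> f a (p + q) = (\<lambda>h. free_action \<nu> \<mu> f a p h + free_action \<nu> \<mu> f a q h)"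
    by (auto simp: free_action_add)
  then show ?case
    by (simp add: clinear_op_add add)
qed (simp add: clinear_op_def)

text \<open>By bilinearity this is a claim about words, where concatenation becomes composition;
  linearity lets the inner scalar out.\<close>

lemma free_action_mult:
  "free_action \<nu> \<mu> f a (p * q) h = free_action \<nu> \<mu> f a p (free_action \<nu> \<mu> f a q h)"
proof (induction p rule: poly_mapping_induct)
  case (single u c)
  show ?case
    by (induction q rule: poly_mapping_induct)
      (simp_all add: mult_single free_action_single word_action_add const_mult distrib_left
        free_action_add clinear_opD[OF clinear_op_word_action] mult.assoc)
qed (simp_all add: distrib_right free_action_add)

lemma free_action_scalar: "free_action \<nu> \<mu> f a (single 0 c) h = const c * h"
  by (simp add: free_action_single word_action_def zero_free_mon_def)

lemma free_action_one: "free_action \<nu> \<mu> f a 1 h = h"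
  using free_action_scalar[of \<nu> \<mu> f a 1 h] by simp

lemma free_action_of_int: "free_action \<nu> \<mu> f a (of_int n) h = of_int n * h"
  using free_action_scalar[of \<nu> \<mu> f a "of_int n" h] by (simp add: const_of_int)

lemma free_action_gen: "free_action \<nu> \<mu> f a (gen x) h = gen_action \<nu> \<mu> f a x h"
  by (simp add: gen_def free_action_single word_action_def)

text \<open>Letters are added on the left, matching the action, in which the leftmost letter acts
  last: the \<open>gen\<close> case costs one application of \<open>gen_action\<close>.\<close>

lemma carrier_free_algebra_induct [consumes 1, case_names scalar add gen]:
  assumes "p \<in> carrier (free_algebra X)"
    and "\<And>c. P (single 0 c)"
    and "\<And>p q. p \<in> carrier (free_algebra X) \<Longrightarrow> q \<in> carrier (free_algebra X) \<Longrightarrow> P p \<Longrightarrow> P q \<Longrightarrow> P (p + q)"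
    and "\<And>x p. x \<in> X \<Longrightarrow> p \<in> carrier (free_algebra X) \<Longrightarrow> P p \<Longrightarrow> P (gen x * p)"
  shows "P p"
proof -
  \<comment> \<open>Membership in the carrier is carried along because the \<open>add\<close> and
    \<open>gen\<close> cases demand it.\<close>
  have "P (single (Word l) c) \<and> single (Word l) c \<in> carrier (free_algebra X)"
    if "set l \<subseteq> X" for l c
    using that
  proof (induction l)
    case Nil
    then show ?case
      using assms(2)[of c] carrier_free_algebra_closed(6)[of c X] by (simp add: zero_free_mon_def)
  next
    case (Cons x l)
    have "single (Word (x # l)) c = gen x * single (Word l) c"
      by (simp add: gen_def mult_single plus_free_mon_def)
    then show ?case
      using Cons assms(4)[of x "single (Word l) c"]
      by (simp add: carrier_free_algebra_mult carrier_free_algebra_closed)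
  qed
  then have *: "P (single w c) \<and> single w c \<in> carrier (free_algebra X)"
    if "set (letters w) \<subseteq> X" for w c
    using that by (cases w) auto
  have "P (\<Sum>w\<in>K. single w (lookup p w)) \<and> (\<Sum>w\<in>K. single w (lookup p w)) \<in> carrier (free_algebra X)"
    if "finite K" "K \<subseteq> keys p" for K
    using that
  proof (induction K)
    case empty
    then show ?case
      using assms(2)[of 0] carrier_free_algebra_closed(1) by simp
  next
    case (insert w K)
    have "set (letters w) \<subseteq> X"
      using insert.prems assms(1) by (auto simp: free_algebra_def)
    with * insert show ?case
      by (auto intro!: assms(3) carrier_free_algebra_closed)
  qed
  from this[of "keys p"] show ?thesis
    by (simp add: sum_monomials)
qed

lemma M_free_simps [simp]:
  "carrier (M_free \<nu> \<mu> f a) = mixed_ring \<nu> \<mu>"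
  "zero (M_free \<nu> \<mu> f a) = 0" "add (M_free \<nu> \<mu> f a) = (+)"
  "smult (M_free \<nu> \<mu> f a) = free_action \<nu> \<mu> f a"
  by (simp_all add: M_free_def)

lemma prod_var_pow_free_of:
  "finite I \<Longrightarrow> I \<inter> X = {} \<Longrightarrow> (\<Prod>i\<in>I. var_pow i (m i)) \<in> free_of X"
  by (induction I rule: finite_induct) (auto intro!: free_of_mult var_pow_free_of one_mem)

lemma prod_var_pow_mixed_ring:
  "finite I \<Longrightarrow> I \<subseteq> {1..\<nu>} \<Longrightarrow> \<forall>i\<in>I. i < \<mu> \<or> 0 \<le> m i \<Longrightarrow>
    (\<Prod>i\<in>I. var_pow i (m i)) \<in> mixed_ring \<nu> \<mu>"
  by (induction I rule: finite_induct) (auto intro!: mixed_ring_mult var_pow_mixed_ring one_mem)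

lemma theta_prod_var_pow:
  "finite I \<Longrightarrow> j \<in> I \<Longrightarrow> theta j (\<Prod>i\<in>I. var_pow i (m i)) = of_int (m j) * (\<Prod>i\<in>I. var_pow i (m i))"
  by (simp add: prod_var_pow theta_single lookup_sum_single const_mult_single flip: const_of_int)

section \<open>The relations of \<open>algB\<close> hold on \<open>M_free\<close>\<close>

context
  fixes \<nu> \<mu> :: nat and f :: "nat \<Rightarrow> laurent" and a :: "nat \<Rightarrow> complex"
  assumes omega: "omega_data \<nu> \<mu> f a"
begin

lemma omega_rank: "1 \<le> \<mu>" "\<mu> \<le> \<nu> + 1" "\<forall>i\<in>{\<mu>..\<nu>}. a i \<noteq> 0"
  using omega by (auto simp: omega_data_def)

lemma omega_mem: "j \<in> {1..<\<mu>} \<Longrightarrow> f j \<in> laurent_in {1..<\<mu>}"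
  using omega by (auto simp: omega_data_def)

lemma omega_free_of: "j \<in> {1..<\<mu>} \<Longrightarrow> f j \<in> free_of (set [\<mu>..<\<nu> + 1])"
  using free_of_antimono[of "set [\<mu>..<\<nu> + 1]" "- {1..<\<mu>}" "f j"] omega_mem[of j]
  unfolding laurent_in_eq_free_of by fastforce

lemma set_indices: "set [\<mu>..<\<nu> + 1] \<subseteq> {\<mu>..\<nu>}"
  by auto

lemmas fold_shift_mixed = fold_shift_mixed_ring[OF omega_rank(1,3) set_indices]
lemmas fold_shift_add = fold_shift_fold_shift[OF omega_rank(1,3) set_indices distinct_upt]
lemmas fold_shift_var = fold_shift_var_mult[OF omega_rank(1,3) set_indices distinct_upt]

lemma gen_action_mixed_ring:
  assumes "x \<in> generators \<nu>" "h \<in> mixed_ring \<nu> \<mu>"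
  shows "gen_action \<nu> \<mu> f a x h \<in> mixed_ring \<nu> \<mu>"
proof -
  consider \<alpha> where "x = E \<alpha>" | j where "x = D j" "j \<in> {1..\<nu>}"
    using assms(1) by (auto simp: generators_def)
  then show ?thesis
  proof cases
    case 1
    then show ?thesis
      using assms(2) omega_rank
      by (auto simp only: gen_action_E intro!: mixed_ring_mult fold_shift_mixed prod_var_pow_mixed_ring)
        auto
  next
    case 2
    then show ?thesis
      using assms(2) laurent_in_mixed_ring[OF omega_rank(2) omega_mem, of j]
      by (auto simp: gen_action_D intro!: mixed_ring_mult mixed_ring_closed theta_mixed_ring var_pow_mixed_ring)
  qed
qed

lemma free_action_mixed_ring:
  assumes "p \<in> carrier (freeB \<nu>)" "h \<in> mixed_ring \<nu> \<mu>"
  shows "free_action \<nu> \<mu> f a p h \<in> mixed_ring \<nu> \<mu>"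
  using assms(1)
  by (induction p rule: carrier_free_algebra_induct)
    (simp_all add: free_action_scalar free_action_add free_action_mult free_action_gen assms(2)
      mixed_ring_mult const_mem mixed_ring_closed gen_action_mixed_ring)

lemma left_module_M_free: "left_module (freeB \<nu>) (M_free \<nu> \<mu> f a)"
proof -
  interpret ring "freeB \<nu>" by (rule ring_free_algebra)
  interpret abelian_group "M_free \<nu> \<mu> f a"
    by (rule abelian_groupI)
      (auto simp: add_ac mixed_ring_closed intro: bexI[of _ "- x" for x])
  show ?thesis
    by unfold_locales
      (simp_all add: free_action_mixed_ring free_action_add free_action_mult free_action_one
        clinear_opD[OF clinear_op_free_action])
qed

text \<open>The monomial contributed by e_\<beta> lives in the invertible variables, so the shifts
  of e_\<alpha> pass through it; both halves then add up separately.\<close>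

lemma gen_action_E_add:
  assumes "h \<in> mixed_ring \<nu> \<mu>"
  shows "gen_action \<nu> \<mu> f a (E \<alpha>) (gen_action \<nu> \<mu> f a (E \<beta>) h) = gen_action \<nu> \<mu> f a (E (\<alpha> + \<beta>)) h"
proof -
  have "(\<Prod>i\<in>{1..<\<mu>}. var_pow i (lookup \<beta> i)) \<in> free_of (set [\<mu>..<\<nu> + 1])"
    by (rule prod_var_pow_free_of) auto
  then show ?thesis
    by (simp only: gen_action_E fold_shift_free_of_mult fold_shift_add[OF assms] lookup_add
        var_pow_add prod.distrib mult.assoc)
qed

lemma gen_action_E_0: "gen_action \<nu> \<mu> f a (E 0) h = h"
  by (simp only: gen_action_E) (simp add: fold_shift_eq_id del: upt_Suc)

text \<open>For i < \<mu> the extra term is the Euler derivative of the monomial in e_\<alpha>, by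
  the Leibniz rule. For i \<ge> \<mu> it arises because e_\<alpha> replaces t_i by t_i -
  \<alpha>_i.\<close>

lemma gen_action_D_E:
  assumes "h \<in> mixed_ring \<nu> \<mu>" "i \<in> {1..\<nu>}"
  shows "gen_action \<nu> \<mu> f a (D i) (gen_action \<nu> \<mu> f a (E \<alpha>) h)
    = gen_action \<nu> \<mu> f a (E \<alpha>) (gen_action \<nu> \<mu> f a (D i) h)
      + of_int (lookup \<alpha> i) * gen_action \<nu> \<mu> f a (E \<alpha>) h"
proof (cases "i < \<mu>")
  case True
  then have i: "i \<in> {1..<\<mu>}" "i \<notin> set [\<mu>..<\<nu> + 1]"
    using assms(2) by auto
  let ?F = "fold_shift a \<alpha> [\<mu>..<\<nu> + 1]"
  have "?F (theta i h + f i * h) = theta i (?F h) + f i * ?F h"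
    by (simp only: clinear_opD[OF clinear_op_fold_shift] theta_fold_shift[OF i(2)]
        fold_shift_free_of_mult[OF omega_free_of[OF i(1)]])
  then show ?thesis
    by (simp only: gen_action_E gen_action_D True if_True theta_mult
        theta_prod_var_pow[OF finite_atLeastLessThan i(1)]) (simp only: algebra_simps)
next
  case False
  then have "i \<in> set [\<mu>..<\<nu> + 1]"
    using assms(2) by auto
  then show ?thesis
    by (simp only: gen_action_E gen_action_D False if_False fold_shift_var[OF assms(1)])
      (simp add: algebra_simps del: upt_Suc)
qed

lemma bform_d_vec: "i \<in> {1..\<nu>} \<Longrightarrow> bform \<nu> (d_vec i) (in_LC \<alpha>) = lookup \<alpha> i"
proof -
  assume i: "i \<in> {1..\<nu>}"
  have "bform \<nu> (d_vec i) (in_LC \<alpha>) = (\<Sum>j=1..\<nu>. if i = j then lookup \<alpha> j else 0)"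
    unfolding bform_def d_vec_def in_LC_def
    by (rule sum.cong) (auto simp: lookup_single when_def)
  with i show ?thesis
    by simp
qed

lemma relB_subset_annihilator: "relB \<nu> \<subseteq> annihilator (freeB \<nu>) (M_free \<nu> \<mu> f a)"
proof
  fix p assume p: "p \<in> relB \<nu>"
  have [simp]: "0 \<in> lattice_of_rank \<nu>"
      "\<alpha> \<in> lattice_of_rank \<nu> \<Longrightarrow> \<beta> \<in> lattice_of_rank \<nu> \<Longrightarrow> \<alpha> + \<beta> \<in> lattice_of_rank \<nu>" for \<alpha> \<beta>
    using Poly_Mapping.keys_add[of \<alpha> \<beta>] by (auto simp: lattice_of_rank_def)
  have gens: "\<alpha> \<in> lattice_of_rank \<nu> \<Longrightarrow> gen (E \<alpha>) \<in> carrier (freeB \<nu>)"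
      "i \<in> {1..\<nu>} \<Longrightarrow> gen (D i) \<in> carrier (freeB \<nu>)"
      "of_int n \<in> carrier (freeB \<nu>)" for \<alpha> i n
    using carrier_free_algebra_closed(6)[of "of_int n" "generators \<nu>"]
    by (auto intro!: carrier_free_algebra_closed simp: generators_def)
  note closed = carrier_free_algebra_closed carrier_free_algebra_mult gens
  note act = free_action_diff free_action_mult free_action_gen free_action_one free_action_of_int
  consider "p = gen (E 0) - 1"
    | \<alpha> \<beta> where "\<alpha> \<in> lattice_of_rank \<nu>" "\<beta> \<in> lattice_of_rank \<nu>"
        "p = gen (E (\<alpha> + \<beta>)) - gen (E \<alpha>) * gen (E \<beta>)"
    | i \<alpha> where "i \<in> {1..\<nu>}" "\<alpha> \<in> lattice_of_rank \<nu>"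
        "p = gen (D i) * gen (E \<alpha>) - gen (E \<alpha>) * gen (D i)
          - of_int (bform \<nu> (d_vec i) (in_LC \<alpha>)) * gen (E \<alpha>)"
    using p unfolding relB_def by blast
  then show "p \<in> annihilator (freeB \<nu>) (M_free \<nu> \<mu> f a)"
  proof cases
    case 1
    then show ?thesis
      by (simp add: annihilator_def closed act gen_action_E_0)
  next
    case 2
    then show ?thesis
      by (simp add: annihilator_def closed act gen_action_E_add)
  next
    case 3
    then show ?thesis
      by (simp add: annihilator_def closed act bform_d_vec gen_action_D_E)
  qed
qed

end

section \<open>Descent to $B$ and $A$\<close>

context
  fixes \<nu> \<mu> :: nat and f :: "nat \<Rightarrow> laurent" and a :: "nat \<Rightarrow> complex"
  assumes omega: "omega_data \<nu> \<mu> f a"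
begin

lemma ideal_idealB: "ideal (idealB \<nu>) (freeB \<nu>)"
proof -
  interpret ring "freeB \<nu>" by (rule ring_free_algebra)
  \<comment> \<open>The annihilator is by definition part of the carrier, so the check of the
    relations also yields this inclusion.\<close>
  have "relB \<nu> \<subseteq> carrier (freeB \<nu>)"
    using relB_subset_annihilator[OF omega] by (auto simp: annihilator_def)
  then show ?thesis
    unfolding idealB_def by (rule genideal_ideal)
qed

lemma M_free_factors: "factors_through_quotient (freeB \<nu>) (idealB \<nu>) (M_free \<nu> \<mu> f a)"
proof -
  interpret left_module "freeB \<nu>" "M_free \<nu> \<mu> f a" by (rule left_module_M_free[OF omega])
  have "idealB \<nu> \<subseteq> annihilator (freeB \<nu>) (M_free \<nu> \<mu> f a)"
    unfolding idealB_def
    by (rule genideal_minimal[OF annihilator_ideal relB_subset_annihilator[OF omega]])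
  then show ?thesis
    using factors_through_quotient_iff[OF left_module_M_free[OF omega] ideal_idealB] by blast
qed

lemma left_module_M_B: "left_module (algB \<nu>) (M_B \<nu> \<mu> f a)"
  unfolding algB_def M_B_def
  by (rule left_module_quotient_module[OF left_module_M_free[OF omega] ideal_idealB M_free_factors])

lemma dB_carrier: "i \<in> {1..\<nu>} \<Longrightarrow> dB \<nu> i \<in> carrier (algB \<nu>)"
  unfolding algB_def dB_def carrier_FactRing
  by (auto simp: generators_def intro!: imageI carrier_free_algebra_closed)

lemma dB_smult:
  assumes "i \<in> {1..\<nu>}" "h \<in> mixed_ring \<nu> \<mu>"
  shows "dB \<nu> i \<odot>\<^bsub>M_B \<nu> \<mu> f a\<^esub> h = gen_action \<nu> \<mu> f a (D i) h"
  using smult_quotient_module[OF M_free_factors, of "gen (D i)" h] assms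
    carrier_free_algebra_closed(7)[of "D i" "generators \<nu>"]
  by (auto simp: dB_def M_B_def free_action_gen generators_def)

lemma ideal_idealA: "ideal (idealA \<nu>) (algB \<nu>)"
proof -
  interpret left_module "algB \<nu>" "M_B \<nu> \<mu> f a" by (rule left_module_M_B)
  show ?thesis
    unfolding idealA_def using dB_carrier by (intro genideal_ideal) auto
qed

text \<open>\<open>idealA\<close> is generated by the commutators of the d_i, and it annihilates the
  module iff these generators do.\<close>

lemma is_A_module_iff_commute:
  "is_A_module \<nu> \<mu> f a \<longleftrightarrow>
    (\<forall>i\<in>{1..\<nu>}. \<forall>j\<in>{1..\<nu>}. \<forall>h\<in>mixed_ring \<nu> \<mu>.
      gen_action \<nu> \<mu> f a (D i) (gen_action \<nu> \<mu> f a (D j) h)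
        = gen_action \<nu> \<mu> f a (D j) (gen_action \<nu> \<mu> f a (D i) h))"
proof -
  interpret left_module "algB \<nu>" "M_B \<nu> \<mu> f a" by (rule left_module_M_B)
  let ?S = "{dB \<nu> i \<otimes>\<^bsub>algB \<nu>\<^esub> dB \<nu> j \<ominus>\<^bsub>algB \<nu>\<^esub> dB \<nu> j \<otimes>\<^bsub>algB \<nu>\<^esub> dB \<nu> i | i j.
               i \<in> {1..\<nu>} \<and> j \<in> {1..\<nu>}}"
  have S: "?S \<subseteq> carrier (algB \<nu>)"
    using dB_carrier by auto
  have M: "carrier (M_B \<nu> \<mu> f a) = mixed_ring \<nu> \<mu>" "\<zero>\<^bsub>M_B \<nu> \<mu> f a\<^esub> = 0"
    by (simp_all add: M_B_def)
  have "is_A_module \<nu> \<mu> f a \<longleftrightarrow> ?S \<subseteq> annihilator (algB \<nu>) (M_B \<nu> \<mu> f a)"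
    unfolding is_A_module_def factors_through_quotient_iff[OF left_module_M_B ideal_idealA]
    unfolding idealA_def by (rule Idl_subset_ideal[OF annihilator_ideal S])
  also have "\<dots> \<longleftrightarrow> (\<forall>i\<in>{1..\<nu>}. \<forall>j\<in>{1..\<nu>}. \<forall>h\<in>mixed_ring \<nu> \<mu>.
      (dB \<nu> i \<otimes>\<^bsub>algB \<nu>\<^esub> dB \<nu> j \<ominus>\<^bsub>algB \<nu>\<^esub> dB \<nu> j \<otimes>\<^bsub>algB \<nu>\<^esub> dB \<nu> i) \<odot>\<^bsub>M_B \<nu> \<mu> f a\<^esub> h
        = \<zero>\<^bsub>M_B \<nu> \<mu> f a\<^esub>)"
    using S unfolding annihilator_def M by blast
  also have "\<dots> \<longleftrightarrow> (\<forall>i\<in>{1..\<nu>}. \<forall>j\<in>{1..\<nu>}. \<forall>h\<in>mixed_ring \<nu> \<mu>.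
      gen_action \<nu> \<mu> f a (D i) (gen_action \<nu> \<mu> f a (D j) h)
        = gen_action \<nu> \<mu> f a (D j) (gen_action \<nu> \<mu> f a (D i) h))"
  proof (intro ball_cong refl)
    fix i j h assume "i \<in> {1..\<nu>}" "j \<in> {1..\<nu>}" "h \<in> mixed_ring \<nu> \<mu>"
    moreover from this have "gen_action \<nu> \<mu> f a (D k) h \<in> mixed_ring \<nu> \<mu>" if "k \<in> {1..\<nu>}" for k
      using that by (intro gen_action_mixed_ring[OF omega]) (auto simp: generators_def)
    ultimately show "(dB \<nu> i \<otimes>\<^bsub>algB \<nu>\<^esub> dB \<nu> j \<ominus>\<^bsub>algB \<nu>\<^esub> dB \<nu> j \<otimes>\<^bsub>algB \<nu>\<^esub> dB \<nu> i) \<odot>\<^bsub>M_B \<nu> \<mu> f a\<^esub> h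
        = \<zero>\<^bsub>M_B \<nu> \<mu> f a\<^esub> \<longleftrightarrow> gen_action \<nu> \<mu> f a (D i) (gen_action \<nu> \<mu> f a (D j) h)
        = gen_action \<nu> \<mu> f a (D j) (gen_action \<nu> \<mu> f a (D i) h)"
      by (subst smult_diff_eq_zero_iff) (simp_all add: dB_carrier M smult_assoc1 dB_smult)
  qed
  finally show ?thesis .
qed

text \<open>For i, j < \<mu> the commutator of d_i and d_j is multiplication by
  \<open>theta i (f j) - theta j (f i)\<close>. All other pairs commute: two variables trivially,
  and t_j with d_i since \<open>theta i\<close> kills t_j.\<close>

lemma is_A_module_iff:
  "is_A_module \<nu> \<mu> f a \<longleftrightarrow> (\<forall>i\<in>{1..<\<mu>}. \<forall>j\<in>{1..<\<mu>}. theta i (f j) = theta j (f i))"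
proof
  assume L: "is_A_module \<nu> \<mu> f a"
  show "\<forall>i\<in>{1..<\<mu>}. \<forall>j\<in>{1..<\<mu>}. theta i (f j) = theta j (f i)"
  proof (intro ballI)
    fix i j assume ij: "i \<in> {1..<\<mu>}" "j \<in> {1..<\<mu>}"
    then have "i \<in> {1..\<nu>}" "j \<in> {1..\<nu>}"
      using omega by (auto simp: omega_data_def)
    \<comment> \<open>Evaluating at 1, which every \<open>theta\<close> kills, leaves the two
      derivatives and the symmetric product of f_i and f_j.\<close>
    then have "gen_action \<nu> \<mu> f a (D i) (gen_action \<nu> \<mu> f a (D j) 1)
        = gen_action \<nu> \<mu> f a (D j) (gen_action \<nu> \<mu> f a (D i) 1)"
      using L one_mem(1) unfolding is_A_module_iff_commute by blast
    with ij show "theta i (f j) = theta j (f i)"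
      by (simp add: gen_action_D theta_free_of one_mem mult.commute)
  qed
next
  assume R: "\<forall>i\<in>{1..<\<mu>}. \<forall>j\<in>{1..<\<mu>}. theta i (f j) = theta j (f i)"
  have theta_comm: "theta i (theta j h) = theta j (theta i h)" for i j h
    by (rule poly_mapping_eqI) (simp add: lookup_theta mult_ac)
  have theta_var: "theta i (var j) = 0" if "i \<noteq> j" for i j
    using that by (intro theta_free_of var_pow_free_of) auto
  show "is_A_module \<nu> \<mu> f a"
    unfolding is_A_module_iff_commute
  proof (intro ballI)
    fix i j h assume "i \<in> {1..\<nu>}" "j \<in> {1..\<nu>}"
    then show "gen_action \<nu> \<mu> f a (D i) (gen_action \<nu> \<mu> f a (D j) h)
        = gen_action \<nu> \<mu> f a (D j) (gen_action \<nu> \<mu> f a (D i) h)"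
      using R by (auto simp: gen_action_D theta_add theta_mult theta_comm[of i j] theta_var algebra_simps)
  qed
qed

lemma simple_module_M_A_iff:
  assumes "is_A_module \<nu> \<mu> f a"
  shows "simple_module (algA \<nu>) (M_A \<nu> \<mu> f a) \<longleftrightarrow> simple_module (freeB \<nu>) (M_free \<nu> \<mu> f a)"
proof -
  have "simple_module (algA \<nu>) (M_A \<nu> \<mu> f a) \<longleftrightarrow> simple_module (algB \<nu>) (M_B \<nu> \<mu> f a)"
    unfolding algA_def M_A_def
    by (rule simple_module_quotient_module_iff[OF left_module_M_B ideal_idealA])
      (use assms in \<open>simp add: is_A_module_def\<close>)
  also have "\<dots> \<longleftrightarrow> simple_module (freeB \<nu>) (M_free \<nu> \<mu> f a)"
    unfolding algB_def M_B_def
    by (rule simple_module_quotient_module_iff[OF left_module_M_free[OF omega] ideal_idealB M_free_factors])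
  finally show ?thesis .
qed

end

lemma module_isomorphic_M_A_iff:
  assumes "omega_data \<nu> \<mu> f a" "omega_data \<nu> \<gamma> g b"
    and "is_A_module \<nu> \<mu> f a" "is_A_module \<nu> \<gamma> g b"
  shows "module_isomorphic (algA \<nu>) (M_A \<nu> \<mu> f a) (M_A \<nu> \<gamma> g b)
    \<longleftrightarrow> module_isomorphic (freeB \<nu>) (M_free \<nu> \<mu> f a) (M_free \<nu> \<gamma> g b)"
proof -
  have "module_isomorphic (algA \<nu>) (M_A \<nu> \<mu> f a) (M_A \<nu> \<gamma> g b)
      \<longleftrightarrow> module_isomorphic (algB \<nu>) (M_B \<nu> \<mu> f a) (M_B \<nu> \<gamma> g b)"
    unfolding algA_def M_A_def
    by (rule module_isomorphic_quotient_module_iff) (use assms in \<open>simp_all add: is_A_module_def\<close>)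
  also have "\<dots> \<longleftrightarrow> module_isomorphic (freeB \<nu>) (M_free \<nu> \<mu> f a) (M_free \<nu> \<gamma> g b)"
    unfolding algB_def M_B_def
    by (rule module_isomorphic_quotient_module_iff) (intro M_free_factors assms)+
  finally show ?thesis .
qed

text \<open>A Poincare lemma on the torus: a closed logarithmic form is exact up to constant
  components.\<close>

lemma theta_commuting_iff_potential:
  assumes f: "\<forall>j\<in>{1..<\<mu>}. f j \<in> laurent_in {1..<\<mu>}"
  shows "(\<forall>i\<in>{1..<\<mu>}. \<forall>j\<in>{1..<\<mu>}. theta i (f j) = theta j (f i)) \<longleftrightarrow>
    (\<exists>P Q. P \<in> laurent_in {1..<\<mu>} \<and>
      (\<forall>j\<in>{1..<\<mu>}. Q j \<in> laurent_in {j} \<and> f j = var j * partial j P + Q j))"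
    (is "?L \<longleftrightarrow> ?R")
proof
  assume ?R
  then obtain P Q where Q: "\<And>j. j \<in> {1..<\<mu>} \<Longrightarrow> Q j \<in> laurent_in {j} \<and> f j = theta j P + Q j"
    unfolding theta_def by blast
  show ?L
  proof (intro ballI)
    fix i j assume ij: "i \<in> {1..<\<mu>}" "j \<in> {1..<\<mu>}"
    have *: "theta i (Q j) = 0" if "i \<noteq> j" "j \<in> {1..<\<mu>}" for i j
      using Q[OF that(2)] that(1) free_of_antimono[of "{i}" "- {j}" "Q j"]
      by (auto simp: laurent_in_eq_free_of intro!: theta_free_of)
    have "theta i (theta j P) = theta j (theta i P)"
      by (rule poly_mapping_eqI) (simp add: lookup_theta mult_ac)
    with * ij Q show "theta i (f j) = theta j (f i)"
      by (cases "i = j") (simp_all add: theta_add)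
  qed
next
  assume L: ?L
  have lookup_eq: "of_int (lookup k i) * lookup (f j) k = of_int (lookup k j) * lookup (f i) k"
    if "i \<in> {1..<\<mu>}" "j \<in> {1..<\<mu>}" for i j k
    using L that by (metis lookup_theta)
  \<comment> \<open>Exponent 0 is left out: every k_j vanishes there, nothing can be divided, and
    this coefficient of f_j goes into Q_j.\<close>
  define K where "K = (\<Union>j\<in>{1..<\<mu>}. keys (f j)) - {0}"
  \<comment> \<open>By \<open>lookup_eq\<close> any index with nonzero k_i gives the same quotient;
    the least one is merely a choice that does not depend on j.\<close>
  define coeff where "coeff = (\<lambda>k. let i = Min (keys k) in lookup (f i) k / of_int (lookup k i))"
  define P where "P = (\<Sum>k\<in>K. single k (coeff k))"
  have lookup_P: "lookup P k = (if k \<in> K then coeff k else 0)" for k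
    by (simp add: P_def K_def lookup_sum lookup_single when_def)
  have K: "keys k \<subseteq> {1..<\<mu>}" "Min (keys k) \<in> keys k" if "k \<in> K" for k
    using that f by (auto simp: K_def laurent_in_def intro!: Min_in)
  have "keys P \<subseteq> K"
    by (auto simp: in_keys_iff lookup_P split: if_splits)
  then have "P \<in> laurent_in {1..<\<mu>}"
    using K(1) unfolding laurent_in_def by blast
  moreover have "f j = var j * partial j P + const (lookup (f j) 0)" if j: "j \<in> {1..<\<mu>}" for j
  proof (rule poly_mapping_eqI)
    fix k
    have "lookup (f j) k = of_int (lookup k j) * lookup P k" if "k \<noteq> 0"
    proof (cases "k \<in> K")
      case True
      let ?i = "Min (keys k)"
      have i: "?i \<in> {1..<\<mu>}" "lookup k ?i \<noteq> 0"
        using K[OF True] by (auto simp: in_keys_iff)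
      \<comment> \<open>This covers k_j = 0 as well: \<open>lookup_eq\<close> then forces the
        coefficient of f_j at k to vanish.\<close>
      then show ?thesis
        using lookup_eq[OF i(1) j, of k] True by (simp add: lookup_P coeff_def Let_def field_simps)
    next
      case False
      then show ?thesis
        using that j by (auto simp: lookup_P K_def in_keys_iff)
    qed
    then show "lookup (f j) k = lookup (var j * partial j P + const (lookup (f j) 0)) k"
      unfolding theta_def[symmetric]
      by (auto simp: lookup_add lookup_theta const_def lookup_single when_def)
  qed
  moreover have "const c \<in> laurent_in {j}" for c j
    by (simp add: laurent_in_eq_free_of const_mem)
  ultimately show ?R
    by (intro exI[of _ P] exI[of _ "\<lambda>j. const (lookup (f j) 0)"]) blast
qed

section \<open>Simplicity\<close>

lemma lookup_partial: "lookup (partial i x) k = of_int (lookup k i + 1) * lookup x (k + single i 1)"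
proof (induction x rule: poly_mapping_induct)
  case (single l c)
  have "l - single i 1 = k \<longleftrightarrow> l = k + single i 1"
    by auto
  then show ?case
    by (auto simp: partial_single lookup_single lookup_add when_def)
qed (simp_all add: partial_add lookup_add distrib_left partial_def[of i 0])

text \<open>The first two terms of the binomial expansion, with the rest kept only as a degree
  bound. For r = 0 the middle term is an inverse power of t_i with coefficient 0.\<close>

lemma linear_power_remainder:
  "(var i - const s) ^ r - var_pow i (int r) + const (s * of_nat r) * var_pow i (int r - 1)
    \<in> supported_on {k. lookup k i \<le> int r - 2}"
proof (induction r)
  case 0
  show ?case
    by (simp add: supported_on_closed)
next
  case (Suc r)
  define R where "R = (var i - const s) ^ r - var_pow i (int r)
    + const (s * of_nat r) * var_pow i (int r - 1)"
  \<comment> \<open>Multiply the expansion for \<open>r\<close> by t_i - s. The new term of exponent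
    r - 1 already lies within the bound, which is \<open>int (Suc r) - 2\<close>.\<close>
  have "(var i - const s) ^ Suc r - var_pow i (int (Suc r))
      + const (s * of_nat (Suc r)) * var_pow i (int (Suc r) - 1)
    = var i * R - const s * R + const (s * s * of_nat r) * var_pow i (int r - 1)"
    using var_pow_add[of i 1 "int r"] var_pow_add[of i 1 "int r - 1"]
    by (simp add: R_def algebra_simps const_mult const_add)
  moreover have "var i * R \<in> supported_on {k. lookup k i \<le> int (Suc r) - 2}"
    unfolding supported_on_def
  proof clarify
    fix k assume "k \<in> keys (var i * R)"
    then obtain l where "k = single i 1 + l" "l \<in> keys R"
      using keys_mult[of "var i" R] by (auto simp: var_pow_def)
    then show "lookup k i \<le> int (Suc r) - 2"
      using Suc by (auto simp: R_def[symmetric] supported_on_def lookup_add)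
  qed
  moreover have "R \<in> supported_on {k. lookup k i \<le> int (Suc r) - 2}"
    using Suc unfolding R_def[symmetric] by (force simp: supported_on_def)
  moreover have "var_pow i (int r - 1) \<in> supported_on {k. lookup k i \<le> int (Suc r) - 2}"
    unfolding var_pow_def by (rule single_supported_on) simp
  ultimately show ?case
    by (simp only: supported_on_closed const_mult_supported_on)
qed

text \<open>Taylor expansion to first order: second derivatives and beyond lower the degree in t_i
  by at least 2.\<close>

lemma subst_shift_remainder:
  assumes "x \<in> nonneg_in i" "\<And>k. k \<in> keys x \<Longrightarrow> lookup k i \<le> n"
  shows "subst_shift i s x - x + const s * partial i x \<in> supported_on {k. lookup k i \<le> n - 2}"
proof (induction x rule: poly_mapping_induct_keys)
  case (single k c)
  define r where "r = nat (lookup k i)"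
  define k' where "k' = k - single i (lookup k i)"
  define R where "R = (var i - const s) ^ r - var_pow i (int r)
    + const (s * of_nat r) * var_pow i (int r - 1)"
  have r: "lookup k i = int r" "int r \<le> n"
    using single assms by (auto simp: r_def nonneg_in_def supported_on_def)
  have "single k' c * var_pow i (int r) = single k c"
    "single k' c * (const (s * of_nat r) * var_pow i (int r - 1))
      = const s * partial i (single k c)"
    by (simp_all add: k'_def r var_pow_def mult_single partial_single const_mult_single
        add_diff_eq diff_add_eq mult_ac flip: single_add single_diff)
      (simp_all add: single_diff)
  then have "subst_shift i s (single k c) - single k c + const s * partial i (single k c)
      = single k' c * R"
    unfolding R_def by (simp only: subst_shift_single r_def[symmetric] k'_def[symmetric]
        right_diff_distrib distrib_left)
  moreover have "single k' c * R \<in> supported_on {k. lookup k i \<le> n - 2}"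
    unfolding supported_on_def
  proof clarify
    fix l assume "l \<in> keys (single k' c * R)"
    then obtain l' where "l = k' + l'" "l' \<in> keys R"
      using keys_mult[of "single k' c" R] by (auto split: if_splits)
    then show "lookup l i \<le> n - 2"
      using linear_power_remainder[of i s r] r
      by (auto simp: R_def[symmetric] supported_on_def lookup_add k'_def lookup_minus)
  qed
  ultimately show ?case by simp
next
  case zero
  then show ?case by (simp add: partial_def supported_on_closed)
next
  case (add g h)
  have "subst_shift i s (g + h) - (g + h) + const s * partial i (g + h)
    = (subst_shift i s g - g + const s * partial i g) + (subst_shift i s h - h + const s * partial i h)"
    by (simp add: subst_shift_add partial_add algebra_simps)
  with add show ?case
    by (simp only: supported_on_closed)
qed

text \<open>Above exponent n - 2 the Taylor remainder is invisible. The first part makes leading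
  terms cancel in differences and compares the scalars a and b; the second shows that a difference
  of positive degree does not vanish.\<close>

lemma lookup_subst_shift_top:
  assumes "x \<in> nonneg_in i" "\<And>k. k \<in> keys x \<Longrightarrow> lookup k i \<le> n"
  shows "lookup k i \<ge> n \<Longrightarrow> lookup (subst_shift i s x) k = lookup x k"
    and "lookup k i = n \<Longrightarrow> lookup (subst_shift i s x) (k - single i 1)
      = lookup x (k - single i 1) - s * of_int n * lookup x k"
proof -
  have *: "lookup (subst_shift i s x) l = lookup x l - s * lookup (partial i x) l"
    if "n - 2 < lookup l i" for l
  proof -
    have "lookup (subst_shift i s x - x + const s * partial i x) l = 0"
      using subst_shift_remainder[OF assms, of s] that by (auto simp: supported_on_iff)
    then show ?thesis
      by (simp add: lookup_add lookup_minus lookup_const_mult eq_diff_eq diff_add_eq)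
  qed
  show "lookup (subst_shift i s x) k = lookup x k" if "lookup k i \<ge> n"
    using *[of k] that assms(2)[of "k + single i 1"]
    by (auto simp: lookup_partial lookup_add in_keys_iff)
  show "lookup (subst_shift i s x) (k - single i 1)
      = lookup x (k - single i 1) - s * of_int n * lookup x k" if "lookup k i = n"
    using *[of "k - single i 1"] that by (simp add: lookup_partial lookup_minus)
qed

lemma mult_single_keys:
  "k \<in> keys (single l c * x) \<Longrightarrow> \<exists>k'\<in>keys x. k = l + k'"
  using keys_mult[of "single l c" x] by (auto split: if_splits)

lemma subst_shift_free_of_other:
  assumes "x \<in> free_of X" "i \<notin> X"
  shows "subst_shift i s x \<in> free_of X"
proof (induction x rule: poly_mapping_induct_keys)
  case (single k c)
  have "single (k - single i (lookup k i)) c \<in> free_of X"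
    unfolding free_of_def
    by (rule single_supported_on)
      (use single assms in \<open>auto simp: free_of_def supported_on_def lookup_minus lookup_single when_def\<close>)
  then show ?case
    using assms(2)
    by (simp add: subst_shift_single free_of_mult free_of_power free_of_closed var_pow_free_of const_mem)
qed (simp_all add: subst_shift_add free_of_closed)

lemma theta_free_of_mem: "x \<in> free_of X \<Longrightarrow> theta i x \<in> free_of X"
  unfolding free_of_def by (rule theta_supported_on)

text \<open>A nonzero element of \<open>N\<close> is stripped of its variables one at a time: an invertible variable by
  minimising the number of its exponents (subtract an eigenvalue of the Euler operator), a polynomial
  variable by minimising the degree (take a difference).\<close>

lemma one_mem_differential_ideal:
  assumes N: "N \<subseteq> mixed_ring \<nu> \<mu>" "x0 \<in> N" "x0 \<noteq> 0"
    and add: "\<And>x y. x \<in> N \<Longrightarrow> y \<in> N \<Longrightarrow> x + y \<in> N"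
    and mult: "\<And>x y. x \<in> mixed_ring \<nu> \<mu> \<Longrightarrow> y \<in> N \<Longrightarrow> x * y \<in> N"
    and theta: "\<And>i x. i \<in> {1..<\<mu>} \<Longrightarrow> i \<le> \<nu> \<Longrightarrow> x \<in> N \<Longrightarrow> theta i x \<in> N"
    and shift: "\<And>i x. i \<in> {\<mu>..\<nu>} \<Longrightarrow> 1 \<le> i \<Longrightarrow> x \<in> N \<Longrightarrow> subst_shift i 1 x \<in> N"
  shows "1 \<in> N"
proof -
  have diff: "x - const c * y \<in> N" if "x \<in> N" "y \<in> N" for x y c
    using add[OF that(1) mult[OF const_mem(1)[of "- c"] that(2)]] by (simp add: const_uminus)
  \<comment> \<open>Variables already removed stay removed, because the operators for t_i bring in
    no other variable.\<close>
  have "m \<le> \<nu> \<Longrightarrow> \<exists>h\<in>N. h \<noteq> 0 \<and> h \<in> free_of {1..m}" for m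
  proof (induction m)
    case 0
    have "x0 \<in> free_of {1..0}"
      by (simp add: free_of_def supported_on_def)
    then show ?case using N by blast
  next
    case (Suc m)
    let ?i = "Suc m"
    define S where "S = {h \<in> N. h \<noteq> 0 \<and> h \<in> free_of {1..m}}"
    have "\<exists>h. h \<in> S"
      using Suc by (auto simp: S_def)
    show ?case
    proof (cases "?i < \<mu>")
      case True
      define d where "d = (\<lambda>h :: laurent. card ((\<lambda>k. lookup k ?i) ` keys h))"
      obtain h where h: "h \<in> S" "\<And>y. y \<in> S \<Longrightarrow> d h \<le> d y"
        using \<open>\<exists>h. h \<in> S\<close> ex_has_least_nat[of "\<lambda>h. h \<in> S" _ d] by blast
      then have "keys h \<noteq> {}"
        by (auto simp: S_def)
      then obtain k0 where k0: "k0 \<in> keys h" by blast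
      define y where "y = theta ?i h - const (of_int (lookup k0 ?i)) * h"
      have lookup_y: "lookup y k = of_int (lookup k ?i - lookup k0 ?i) * lookup h k" for k
        by (simp add: y_def lookup_minus lookup_theta lookup_const_mult left_diff_distrib)
      \<comment> \<open>The support of \<open>y\<close> lies in that of \<open>h\<close> and misses
        the exponent of \<open>k0\<close>, so a nonzero \<open>y\<close> would contradict
        minimality.\<close>
      have "y = 0"
      proof (rule ccontr)
        assume "y \<noteq> 0"
        then have "y \<in> S"
          using h(1) True Suc.prems
          by (auto simp: S_def y_def intro!: diff theta free_of_closed free_of_mult const_mem theta_free_of_mem)
        moreover have "d y < d h"
          unfolding d_def
        proof (rule psubset_card_mono)
          show "(\<lambda>k. lookup k ?i) ` keys y \<subset> (\<lambda>k. lookup k ?i) ` keys h"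
            using k0 by (force simp: in_keys_iff lookup_y)
        qed simp
        ultimately show False
          using h(2) by (meson not_le)
      qed
      then have k: "lookup k ?i = lookup k0 ?i" if "k \<in> keys h" for k
        using lookup_y[of k] that by (simp add: in_keys_iff)
      \<comment> \<open>A single exponent of t_i is left, and t_i is invertible here, so it can be
        divided out inside the ideal.\<close>
      define z where "z = var_pow ?i (- lookup k0 ?i) * h"
      have "var_pow ?i (lookup k0 ?i) * z = h"
        using var_pow_add[of ?i "lookup k0 ?i" "- lookup k0 ?i"] by (simp add: z_def flip: mult.assoc)
      then have "z \<noteq> 0"
        using h(1) by (auto simp: S_def)
      moreover have "z \<in> N"
        unfolding z_def using h(1) True Suc.prems by (auto simp: S_def intro!: mult var_pow_mixed_ring)
      moreover have "z \<in> free_of {1..Suc m}"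
        unfolding free_of_def supported_on_def
      proof clarify
        fix l j assume l: "l \<in> keys z" and j: "j \<in> {1..Suc m}"
        then obtain l' where l': "l' \<in> keys h" "l = single ?i (- lookup k0 ?i) + l'"
          using mult_single_keys[of l] unfolding z_def var_pow_def by blast
        show "lookup l j = 0"
        proof (cases "j = ?i")
          case True
          then show ?thesis using l' k by (simp add: lookup_add)
        next
          case False
          then have "lookup l' j = 0"
            using h(1) l'(1) j by (auto simp: S_def free_of_def supported_on_def)
          then show ?thesis using l' False by (simp add: lookup_add lookup_single)
        qed
      qed
      ultimately show ?thesis by blast
    next
      case False
      then have i: "?i \<in> {\<mu>..\<nu>}"
        using Suc.prems by simp
      define d where "d = (\<lambda>h :: laurent. nat (Max ((\<lambda>k. lookup k ?i) ` keys h)))"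
      obtain h where h: "h \<in> S" "\<And>y. y \<in> S \<Longrightarrow> d h \<le> d y"
        using \<open>\<exists>h. h \<in> S\<close> ex_has_least_nat[of "\<lambda>h. h \<in> S" _ d] by blast
      define n where "n = Max ((\<lambda>k. lookup k ?i) ` keys h)"
      have nonneg: "h \<in> nonneg_in ?i"
        using h(1) N(1) i mixed_ring_nonneg_in by (auto simp: S_def)
      have le_n: "lookup k ?i \<le> n" if "k \<in> keys h" for k
        unfolding n_def using that by simp
      have "keys h \<noteq> {}"
        using h(1) by (auto simp: S_def)
      then have "n \<in> (\<lambda>k. lookup k ?i) ` keys h"
        unfolding n_def by (intro Max_in) auto
      then obtain k0 where k0: "k0 \<in> keys h" "lookup k0 ?i = n"
        by auto
      have "n \<ge> 0"
        using k0 nonneg by (auto simp: nonneg_in_def supported_on_def)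
      have "n = 0"
      proof (rule ccontr)
        assume "n \<noteq> 0"
        define y where "y = subst_shift ?i 1 h - const 1 * h"
        \<comment> \<open>One step below the top the difference has coefficient -n times that of
          \<open>h\<close> at \<open>k0\<close>, which is nonzero.\<close>
        have "lookup y (k0 - single ?i 1) \<noteq> 0"
          using lookup_subst_shift_top(2)[OF nonneg le_n k0(2), of 1] k0 \<open>n \<noteq> 0\<close>
          by (simp add: y_def lookup_minus in_keys_iff)
        then have "y \<noteq> 0" by auto
        moreover have "y \<in> N"
          unfolding y_def using h(1) i by (intro diff shift) (auto simp: S_def)
        moreover have "y \<in> free_of {1..m}"
          unfolding y_def using h(1)
          by (intro free_of_closed(4) free_of_mult const_mem subst_shift_free_of_other) (auto simp: S_def)
        ultimately have "y \<in> S"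
          by (simp add: S_def)
        \<comment> \<open>The top layers of \<open>h\<close> and of its shift agree and
          cancel.\<close>
        have "lookup k ?i < n" if "k \<in> keys y" for k
          using lookup_subst_shift_top(1)[OF nonneg le_n, of k 1] that
          by (force simp: y_def in_keys_iff lookup_minus)
        moreover have "Max ((\<lambda>k. lookup k ?i) ` keys y) \<in> (\<lambda>k. lookup k ?i) ` keys y"
          using \<open>y \<noteq> 0\<close> by (intro Max_in) auto
        ultimately have "Max ((\<lambda>k. lookup k ?i) ` keys y) < n" by auto
        then have "d y < d h"
          using \<open>n \<noteq> 0\<close> \<open>n \<ge> 0\<close> by (simp add: d_def flip: n_def)
        then show False
          using h(2) \<open>y \<in> S\<close> by (meson not_le)
      qed
      have "h \<in> free_of {1..Suc m}"
        unfolding free_of_def supported_on_def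
      proof clarify
        fix l j assume l: "l \<in> keys h" and j: "j \<in> {1..Suc m}"
        show "lookup l j = 0"
        proof (cases "j = ?i")
          case True
          then show ?thesis
            using le_n[OF l] \<open>n = 0\<close> nonneg l by (force simp: nonneg_in_def supported_on_def)
        next
          case False
          then show ?thesis
            using h(1) l j by (auto simp: S_def free_of_def supported_on_def)
        qed
      qed
      then show ?thesis
        using h(1) by (auto simp: S_def)
    qed
  qed
  from this[of \<nu>] obtain h where h: "h \<in> N" "h \<noteq> 0" "h \<in> free_of {1..\<nu>}" by blast
  \<comment> \<open>Elements of the mixed ring involve t_1, ..., t_\<nu> only, and these have all
    been removed: a nonzero constant remains.\<close>
  have "k = 0" if "k \<in> keys h" for k
  proof (rule poly_mapping_eqI)
    fix i
    have "k \<in> mixed_exps \<nu> \<mu>" "\<forall>i\<in>{1..\<nu>}. lookup k i = 0"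
      using that h N(1) by (auto simp: free_of_def supported_on_def mixed_ring_eq)
    then show "lookup k i = lookup 0 i"
      by (cases "i \<in> {1..\<nu>}") (simp_all add: mixed_exps_iff)
  qed
  then have "h = const (lookup h 0)"
    by (intro poly_mapping_eqI) (auto simp: const_def lookup_single when_def in_keys_iff)
  then obtain c where "h = const c" "c \<noteq> 0"
    using h(2) by (metis const_simps(1))
  then have "const (inverse c) * h = 1"
    by (simp flip: const_mult)
  then show ?thesis
    using mult[OF const_mem(1) h(1), of "inverse c"] by simp
qed

section \<open>Multiplications as elements of the free algebra\<close>

lemma fold_shift_single:
  assumes "i \<in> set l" "distinct l"
  shows "fold_shift a (single i m) l x = exp_shift_pow (a i) i m x"
  using assms
proof (induction l arbitrary: x)
  case (Cons j l)
  show ?case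
  proof (cases "j = i")
    case True
    then have "\<forall>k\<in>set l. lookup (single i m) k = 0"
      using Cons.prems by (auto simp: lookup_single when_def)
    then show ?thesis
      using True by (simp add: fold_shift_eq_id)
  next
    case False
    then show ?thesis
      using Cons by (simp add: lookup_single)
  qed
qed simp

lemma gen_action_E_single:
  assumes "1 \<le> \<mu>" "i \<in> {1..\<nu>}"
  shows "gen_action \<nu> \<mu> f a (E (single i m)) h
    = (if i < \<mu> then var_pow i m * h else exp_shift_pow (a i) i m h)"
proof (cases "i < \<mu>")
  case True
  have "(\<Prod>j\<in>{1..<\<mu>}. var_pow j (lookup (single i m) j)) = (\<Prod>j\<in>{1..<\<mu>}. if j = i then var_pow i m else 1)"
    by (rule prod.cong) (auto simp: lookup_single when_def)
  also have "\<dots> = var_pow i m"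
    using True assms by simp
  finally show ?thesis
    unfolding gen_action_E using True by (subst fold_shift_eq_id) (auto simp: lookup_single)
next
  case False
  have "(\<Prod>j\<in>{1..<\<mu>}. var_pow j (lookup (single i m) j)) = 1"
    using False by (intro prod.neutral) (auto simp: lookup_single)
  moreover have "i \<in> set [\<mu>..<\<nu> + 1]"
    using False assms by auto
  ultimately show ?thesis
    unfolding gen_action_E using False by (simp add: fold_shift_single del: upt_Suc)
qed

lemma E_single_generator: "i \<in> {1..\<nu>} \<Longrightarrow> E (single i m) \<in> generators \<nu>"
  by (auto simp: generators_def lattice_of_rank_def)

lemma D_generator: "i \<in> {1..\<nu>} \<Longrightarrow> D i \<in> generators \<nu>"
  by (auto simp: generators_def)

text \<open>Powers of t_i come from multiples of c_i when i < \<mu>, and t_i is d_i when i \<ge>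
  \<mu>. The order of quantifiers matters: \<open>p\<close> is fixed before f and a, so it
  multiplies by \<open>x\<close> on every module with the same \<mu>.\<close>

lemma mixed_ring_element_action:
  assumes "1 \<le> \<mu>" "x \<in> mixed_ring \<nu> \<mu>"
  shows "\<exists>p\<in>carrier (freeB \<nu>). \<forall>f a h. free_action \<nu> \<mu> f a p h = x * h"
proof -
  define X where "X = {x. \<exists>p\<in>carrier (freeB \<nu>). \<forall>f a h. free_action \<nu> \<mu> f a p h = x * h}"
  have XI: "x \<in> X" if "p \<in> carrier (freeB \<nu>)" "\<And>f a h. free_action \<nu> \<mu> f a p h = x * h" for x p
    using that by (auto simp: X_def)
  have const: "const c \<in> X" for c
    by (rule XI[of "single 0 c"]) (simp_all add: carrier_free_algebra_closed free_action_scalar)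
  have mult: "x * y \<in> X" if "x \<in> X" "y \<in> X" for x y
  proof -
    obtain p q where "p \<in> carrier (freeB \<nu>)" "\<And>f a h. free_action \<nu> \<mu> f a p h = x * h"
        "q \<in> carrier (freeB \<nu>)" "\<And>f a h. free_action \<nu> \<mu> f a q h = y * h"
      using \<open>x \<in> X\<close> \<open>y \<in> X\<close> unfolding X_def by blast
    then show ?thesis
      by (intro XI[of "p * q"]) (simp_all add: carrier_free_algebra_mult free_action_mult mult.assoc)
  qed
  have add: "x + y \<in> X" if "x \<in> X" "y \<in> X" for x y
  proof -
    obtain p q where "p \<in> carrier (freeB \<nu>)" "\<And>f a h. free_action \<nu> \<mu> f a p h = x * h"
        "q \<in> carrier (freeB \<nu>)" "\<And>f a h. free_action \<nu> \<mu> f a q h = y * h"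
      using \<open>x \<in> X\<close> \<open>y \<in> X\<close> unfolding X_def by blast
    then show ?thesis
      by (intro XI[of "p + q"]) (simp_all add: carrier_free_algebra_closed free_action_add distrib_right)
  qed
  have var: "var_pow i m \<in> X" if "i \<in> {1..\<nu>}" "i < \<mu> \<or> 0 \<le> m" for i m
  proof (cases "i < \<mu>")
    case True
    then show ?thesis
      using assms(1) that
      by (intro XI[of "gen (E (single i m))"])
        (auto simp: free_action_gen gen_action_E_single intro!: carrier_free_algebra_closed E_single_generator)
  next
    case False
    then have "var i \<in> X"
      using that
      by (intro XI[of "gen (D i)"])
        (auto simp: free_action_gen gen_action_D intro!: carrier_free_algebra_closed D_generator)
    then have "var i ^ n \<in> X" for n
      using const[of 1] by (induction n) (simp_all add: mult)
    then show ?thesis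
      using that False by (simp add: var_power all_nat[symmetric]) (metis nat_0_le)
  qed
  have "x \<in> X"
  proof (induction x rule: poly_mapping_induct_keys)
    case (single k c)
    then have k: "k \<in> mixed_exps \<nu> \<mu>"
      using assms(2) by (auto simp: mixed_ring_eq supported_on_def)
    have "(\<Prod>i\<in>I. var_pow i (lookup k i)) \<in> X" if "finite I" "I \<subseteq> {1..\<nu>}" for I
      using that
    proof (induction I)
      case empty
      show ?case using const[of 1] by simp
    next
      case (insert i I)
      then show ?case
        using k by (auto intro!: mult var simp: mixed_exps_iff)
    qed
    then have "const c * (\<Prod>i\<in>{1..\<nu>}. var_pow i (lookup k i)) \<in> X"
      by (intro mult const) auto
    moreover have "(\<Sum>i\<in>{1..\<nu>}. single i (lookup k i)) = k"
      using k by (intro poly_mapping_eqI) (auto simp: lookup_sum_single mixed_exps_iff)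
    ultimately show ?case
      by (simp add: prod_var_pow const_mult_single)
  next
    case zero
    then show ?case using const[of 0] by simp
  qed (rule add)
  then show ?thesis
    by (simp add: X_def)
qed

lemma simple_module_M_free:
  assumes omega: "omega_data \<nu> \<mu> f a"
  shows "simple_module (freeB \<nu>) (M_free \<nu> \<mu> f a)"
proof -
  note rank = omega_rank[OF omega]
  have "N = carrier (M_free \<nu> \<mu> f a)"
    if N: "submodule N (freeB \<nu>) (M_free \<nu> \<mu> f a)" and N0: "N \<noteq> {0}" for N
  proof -
    interpret submodule N "freeB \<nu>" "M_free \<nu> \<mu> f a" by (rule N)
    have sub: "N \<subseteq> mixed_ring \<nu> \<mu>" and zero: "0 \<in> N"
      and add: "\<And>x y. x \<in> N \<Longrightarrow> y \<in> N \<Longrightarrow> x + y \<in> N"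
      using subset one_closed m_closed by simp_all
    have act: "free_action \<nu> \<mu> f a p x \<in> N" if "p \<in> carrier (freeB \<nu>)" "x \<in> N" for p x
      using smult_closed[OF that] by simp
    have gen: "gen_action \<nu> \<mu> f a y x \<in> N" if "y \<in> generators \<nu>" "x \<in> N" for x y
      using act[of "gen y" x] that by (simp add: carrier_free_algebra_closed free_action_gen)
    have mult: "x * y \<in> N" if "x \<in> mixed_ring \<nu> \<mu>" "y \<in> N" for x y
      using mixed_ring_element_action[OF rank(1) that(1)] act[OF _ that(2)] by metis
    obtain x0 where "x0 \<in> N" "x0 \<noteq> 0"
      using N0 zero by blast
    have "1 \<in> N"
    proof (rule one_mem_differential_ideal[OF sub \<open>x0 \<in> N\<close> \<open>x0 \<noteq> 0\<close> add mult])
      fix i x assume i: "i \<in> {1..<\<mu>}" "i \<le> \<nu>" and x: "x \<in> N"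
      have "theta i x + f i * x \<in> N"
        using gen[OF D_generator x, of i] i by (simp add: gen_action_D)
      \<comment> \<open>d_i acts as \<open>theta i\<close> plus multiplication by f_i; the second
        part preserves the ideal \<open>N\<close> and can be subtracted.\<close>
      moreover have "const (- 1) * (f i * x) \<in> N"
        using laurent_in_mixed_ring[OF rank(2) omega_mem[OF omega i(1)]] x
        by (intro mult const_mem)
      ultimately show "theta i x \<in> N"
        using add by (fastforce simp: const_uminus)
    next
      fix i x assume i: "i \<in> {\<mu>..\<nu>}" "1 \<le> i" and x: "x \<in> N"
      have "const (a i) * subst_shift i 1 x \<in> N"
        using gen[OF E_single_generator x, of i 1] i rank(1)
        by (simp add: gen_action_E_single exp_shift_pow_def)
      then have "const (inverse (a i)) * (const (a i) * subst_shift i 1 x) \<in> N"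
        by (rule mult[OF const_mem(1)])
      then show "subst_shift i 1 x \<in> N"
        using rank(3) i by (simp flip: const_mult mult.assoc)
    qed
    then show ?thesis
      using mult[of _ 1] sub by auto
  qed
  moreover have "mixed_ring \<nu> \<mu> \<noteq> {0}"
    by (metis one_mem(1) singletonD zero_neq_one)
  ultimately show ?thesis
    using left_module_M_free[OF omega] by (auto simp: simple_module_def)
qed

text \<open>Leading coefficients multiply. Uniqueness of the decomposition holds for the largest
  exponents of both factors, and likewise for the smallest.\<close>

lemma lookup_mult_unique:
  fixes q u :: laurent
  assumes k: "k0 \<in> keys q" and l: "l0 \<in> keys u"
    and unique: "\<And>k l. k \<in> keys q \<Longrightarrow> l \<in> keys u \<Longrightarrow> k + l = k0 + l0 \<Longrightarrow> k = k0 \<and> l = l0"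
  shows "lookup (q * u) (k0 + l0) = lookup q k0 * lookup u l0"
proof -
  have "q * u = (\<Sum>k\<in>keys q. single k (lookup q k)) * (\<Sum>l\<in>keys u. single l (lookup u l))"
    by (simp only: sum_monomials)
  also have "\<dots> = (\<Sum>(k, l)\<in>keys q \<times> keys u. single (k + l) (lookup q k * lookup u l))"
    by (simp add: sum_product sum.cartesian_product mult_single)
  finally have "lookup (q * u) (k0 + l0)
      = (\<Sum>(k, l)\<in>keys q \<times> keys u. lookup (single (k + l) (lookup q k * lookup u l)) (k0 + l0))"
    by (simp add: lookup_sum case_prod_unfold)
  also have "\<dots> = (\<Sum>p\<in>keys q \<times> keys u. if p = (k0, l0) then lookup q k0 * lookup u l0 else 0)"
    by (intro sum.cong) (auto simp: lookup_single when_def dest: unique split: if_splits)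
  also have "\<dots> = lookup q k0 * lookup u l0"
    using k l by simp
  finally show ?thesis .
qed

text \<open>Compare the extreme exponents of both sides: multiplication by \<open>q\<close> may not enlarge the support
  of \<open>u\<close>, so \<open>q\<close> is an eigenvalue of the Euler operator.\<close>

lemma mult_eq_theta_imp_Ints:
  assumes "q * u = theta i u" "u \<noteq> 0"
  shows "q \<in> \<int>"
proof -
  have keys_u: "keys u \<noteq> {}"
    using assms(2) by simp
  \<comment> \<open>Euler operators rescale coefficients and create no new exponents.\<close>
  have sub: "keys (q * u) \<subseteq> keys u"
    using assms(1) by (auto simp: in_keys_iff lookup_theta)
  have key0: "k = 0" if k: "k \<in> keys q" for k
  proof -
    have keys_q: "keys q \<noteq> {}"
      using k by auto
    \<comment> \<open>Exponents carry a linear order compatible with addition. The top terms of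
      \<open>q\<close> and \<open>u\<close> do not cancel, so their sum is an exponent of
      \<open>u\<close> and cannot exceed the largest one.\<close>
    have "Max (keys q) \<le> 0"
    proof -
      have "lookup (q * u) (Max (keys q) + Max (keys u))
          = lookup q (Max (keys q)) * lookup u (Max (keys u))"
      proof (rule lookup_mult_unique)
        fix k l assume kl: "k \<in> keys q" "l \<in> keys u" "k + l = Max (keys q) + Max (keys u)"
        then have "k \<le> Max (keys q)" "l \<le> Max (keys u)"
          by auto
        with kl(3) show "k = Max (keys q) \<and> l = Max (keys u)"
          by (metis add_le_less_mono add_less_le_mono less_irrefl order_le_less)
      qed (use keys_u keys_q in auto)
      also have "\<dots> \<noteq> 0"
        using Max_in[of "keys q"] Max_in[of "keys u"] keys_u keys_q by (simp add: in_keys_iff)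
      finally have "Max (keys q) + Max (keys u) \<in> keys u"
        using sub by (auto simp: in_keys_iff)
      then have "Max (keys q) + Max (keys u) \<le> Max (keys u)"
        by (rule Max_ge[OF finite_keys])
      then show ?thesis
        by (simp add: add_le_same_cancel2)
    qed
    moreover have "Min (keys q) \<ge> 0"
    proof -
      have "lookup (q * u) (Min (keys q) + Min (keys u))
          = lookup q (Min (keys q)) * lookup u (Min (keys u))"
      proof (rule lookup_mult_unique)
        fix k l assume kl: "k \<in> keys q" "l \<in> keys u" "k + l = Min (keys q) + Min (keys u)"
        then have "Min (keys q) \<le> k" "Min (keys u) \<le> l"
          by auto
        with kl(3) show "k = Min (keys q) \<and> l = Min (keys u)"
          by (metis add_le_less_mono add_less_le_mono less_irrefl order_le_less)
      qed (use keys_u keys_q in auto)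
      also have "\<dots> \<noteq> 0"
        using Min_in[of "keys q"] Min_in[of "keys u"] keys_u keys_q by (simp add: in_keys_iff)
      finally have "Min (keys q) + Min (keys u) \<in> keys u"
        using sub by (auto simp: in_keys_iff)
      then have "Min (keys u) \<le> Min (keys q) + Min (keys u)"
        by (rule Min_le[OF finite_keys])
      then show ?thesis
        by (simp add: le_add_same_cancel2)
    qed
    moreover have "Min (keys q) \<le> k" "k \<le> Max (keys q)"
      using k by auto
    ultimately show "k = 0"
      by (meson order.antisym order.trans)
  qed
  have q: "q = const (lookup q 0)"
    using key0 by (intro poly_mapping_eqI) (auto simp: const_def lookup_single when_def in_keys_iff)
  obtain l where l: "l \<in> keys u"
    using keys_u by blast
  \<comment> \<open>With \<open>q\<close> constant, any single exponent \<open>l\<close> of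
    \<open>u\<close> shows that the eigenvalue is the integer \<open>lookup l i\<close>.\<close>
  have "lookup (q * u) l = lookup q 0 * lookup u l"
    by (subst q) (rule lookup_const_mult)
  then have "lookup q 0 = of_int (lookup l i)"
    using l assms(1) by (simp add: lookup_theta in_keys_iff)
  then have "q = of_int (lookup l i)"
    using q by (simp add: const_of_int)
  then show ?thesis by simp
qed

section \<open>Isomorphisms\<close>

lemma module_isomorphic_sym:
  assumes "left_module R M" "module_isomorphic R M N"
  shows "module_isomorphic R N M"
proof -
  interpret left_module R M by fact
  obtain \<phi> where \<phi>: "\<phi> \<in> module_hom R M N" and bij: "bij_betw \<phi> (carrier M) (carrier N)"
    using assms(2) by (auto simp: module_isomorphic_def)
  define \<psi> where "\<psi> = inv_into (carrier M) \<phi>"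
  have bij': "bij_betw \<psi> (carrier N) (carrier M)"
    unfolding \<psi>_def by (rule bij_betw_inv_into[OF bij])
  have mem: "\<psi> x \<in> carrier M" and right: "\<phi> (\<psi> x) = x" if "x \<in> carrier N" for x
    using that bij bij' by (auto simp: \<psi>_def bij_betw_apply bij_betw_inv_into_right)
  have left: "\<psi> y = x" if "x \<in> carrier M" "\<phi> x = y" for x y
    using that bij by (auto simp: \<psi>_def bij_betw_inv_into_left)
  have "\<psi> \<in> module_hom R N M"
    unfolding module_hom_def
  proof (intro CollectI conjI ballI)
    fix x y assume "x \<in> carrier N" "y \<in> carrier N"
    then show "\<psi> (x \<oplus>\<^bsub>N\<^esub> y) = \<psi> x \<oplus>\<^bsub>M\<^esub> \<psi> y"
      using \<phi> mem right by (intro left) (auto simp: module_hom_def)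
  next
    fix r x assume "r \<in> carrier R" "x \<in> carrier N"
    then show "\<psi> (r \<odot>\<^bsub>N\<^esub> x) = r \<odot>\<^bsub>M\<^esub> \<psi> x"
      using \<phi> mem right by (intro left) (auto simp: module_hom_def smult_closed)
  qed (rule mem)
  with bij' show ?thesis
    by (auto simp: module_isomorphic_def)
qed

section \<open>Consequences of an injective homomorphism\<close>

context
  fixes \<nu> \<mu> \<gamma> :: nat and f g :: "nat \<Rightarrow> laurent" and a b :: "nat \<Rightarrow> complex"
    and \<phi> :: "laurent \<Rightarrow> laurent"
  assumes omega1: "omega_data \<nu> \<mu> f a" and omega2: "omega_data \<nu> \<gamma> g b"
    and hom: "\<phi> \<in> module_hom (freeB \<nu>) (M_free \<nu> \<mu> f a) (M_free \<nu> \<gamma> g b)"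
    and inj: "inj_on \<phi> (mixed_ring \<nu> \<mu>)"
begin

lemma hom_free_action:
  "p \<in> carrier (freeB \<nu>) \<Longrightarrow> h \<in> mixed_ring \<nu> \<mu> \<Longrightarrow>
    \<phi> (free_action \<nu> \<mu> f a p h) = free_action \<nu> \<gamma> g b p (\<phi> h)"
  using hom by (simp add: module_hom_def)

lemma hom_gen_action:
  "x \<in> generators \<nu> \<Longrightarrow> h \<in> mixed_ring \<nu> \<mu> \<Longrightarrow>
    \<phi> (gen_action \<nu> \<mu> f a x h) = gen_action \<nu> \<gamma> g b x (\<phi> h)"
  using hom_free_action[of "gen x" h] by (simp add: carrier_free_algebra_closed free_action_gen)

lemma hom_const_mult: "h \<in> mixed_ring \<nu> \<mu> \<Longrightarrow> \<phi> (const c * h) = const c * \<phi> h"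
  using hom_free_action[of "single 0 c" h] by (simp add: carrier_free_algebra_closed free_action_scalar)

lemma hom_one_nonzero: "\<phi> 1 \<noteq> 0"
proof
  assume "\<phi> 1 = 0"
  moreover have "\<phi> 0 = 0"
    using hom_const_mult[OF one_mem(1), of 0] by simp
  ultimately show False
    using inj_onD[OF inj, of 1 0] by (simp add: one_mem mixed_ring_closed)
qed

lemma hom_one_mem: "\<phi> 1 \<in> mixed_ring \<nu> \<gamma>"
  using hom one_mem(1) by (simp add: module_hom_def)

lemma hom_exp_shift_one:
  assumes "i \<in> {\<mu>..\<nu>}"
  shows "gen_action \<nu> \<gamma> g b (E (single i 1)) (\<phi> 1) = const (a i) * \<phi> 1"
proof -
  have i: "i \<in> {1..\<nu>}"
    using assms omega_rank[OF omega1] by auto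
  then have "gen_action \<nu> \<mu> f a (E (single i 1)) 1 = const (a i) * 1"
    using assms omega_rank[OF omega1]
    by (simp add: gen_action_E_single exp_shift_pow_def subst_shift_free_of one_mem)
  then show ?thesis
    using hom_gen_action[OF E_single_generator[OF i] one_mem(1)] hom_const_mult[OF one_mem(1)] by metis
qed

text \<open>The shift by \<open>c\<^sub>i\<close> has the eigenvector \<open>1\<close> in the polynomial case, but acts as
  multiplication by \<open>t\<^sub>i\<close>, without eigenvectors, in the Laurent case.\<close>

lemma hom_rank_le: "\<gamma> \<le> \<mu>"
proof (rule ccontr)
  assume "\<not> \<gamma> \<le> \<mu>"
  \<comment> \<open>The test index is \<mu> itself: its variable is polynomial in the source and
    invertible in the target.\<close>
  then have i: "\<mu> \<in> {\<mu>..\<nu>}" "\<mu> \<in> {1..\<nu>}" "\<mu> < \<gamma>"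
    using omega_rank[OF omega1] omega_rank[OF omega2] by auto
  then have "var \<mu> * \<phi> 1 = const (a \<mu>) * \<phi> 1"
    using hom_exp_shift_one[OF i(1)] omega_rank[OF omega2] by (simp add: gen_action_E_single)
  then have "var \<mu> = const (a \<mu>)"
    using hom_one_nonzero by simp
  then have "lookup (var \<mu>) (single \<mu> 1) = lookup (const (a \<mu>)) (single \<mu> 1)"
    by simp
  then show False
    by (simp add: var_pow_def const_def lookup_single when_def)
qed

text \<open>The image of 1 is an eigenvector of e_(c_j) on the target with eigenvalue a_j. The shift
  preserves its leading coefficients in t_j, so the eigenvalue can only be b_j.\<close>

lemma hom_scalars_eq:
  assumes "\<mu> = \<gamma>" "j \<in> {\<mu>..\<nu>}"
  shows "a j = b j"
proof -
  let ?u = "\<phi> 1"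
  have j: "j \<in> {1..\<nu>}"
    using assms(2) omega_rank[OF omega1] by auto
  have eq: "const (b j) * subst_shift j 1 ?u = const (a j) * ?u"
    using hom_exp_shift_one[OF assms(2)] assms j omega_rank[OF omega2]
    by (simp add: gen_action_E_single exp_shift_pow_def)
  have nonneg: "?u \<in> nonneg_in j"
    using hom_one_mem assms by (intro mixed_ring_nonneg_in[of _ \<nu> \<mu>]) auto
  define n where "n = Max ((\<lambda>k. lookup k j) ` keys ?u)"
  have "n \<in> (\<lambda>k. lookup k j) ` keys ?u"
    unfolding n_def using hom_one_nonzero by (intro Max_in) auto
  then obtain k where k: "k \<in> keys ?u" "lookup k j = n"
    by auto
  have le: "lookup l j \<le> n" if "l \<in> keys ?u" for l
    unfolding n_def using that by simp
  have "lookup (const (b j) * subst_shift j 1 ?u) k = lookup (const (a j) * ?u) k"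
    by (simp only: eq)
  then show ?thesis
    using k lookup_subst_shift_top(1)[OF nonneg le, of k 1]
    by (simp add: lookup_const_mult in_keys_iff)
qed

lemma hom_potentials_diff:
  assumes "\<mu> = \<gamma>" "j \<in> {1..<\<mu>}"
  shows "f j - g j \<in> \<int>"
proof -
  have j: "j \<in> {1..\<nu>}" "j < \<mu>"
    using assms omega_rank[OF omega1] by auto
  have fj: "f j \<in> mixed_ring \<nu> \<mu>"
    by (rule laurent_in_mixed_ring[OF omega_rank(2)[OF omega1] omega_mem[OF omega1 assms(2)]])
  \<comment> \<open>On the source d_j sends 1 to f_j, and so does \<open>p\<close>. Since
    \<open>p\<close> multiplies by f_j on the target too, the homomorphism carries over the equation
    between d_j and f_j.\<close>
  then obtain p where p: "p \<in> carrier (freeB \<nu>)" "\<forall>f' a' h. free_action \<nu> \<mu> f' a' p h = f j * h"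
    using mixed_ring_element_action[OF omega_rank(1)[OF omega1] fj] by blast
  have "gen_action \<nu> \<mu> f a (D j) 1 = free_action \<nu> \<mu> f a p 1"
    using p(2) j by (simp add: gen_action_D theta_free_of one_mem)
  then have "gen_action \<nu> \<gamma> g b (D j) (\<phi> 1) = free_action \<nu> \<gamma> g b p (\<phi> 1)"
    using hom_gen_action[OF D_generator[OF j(1)] one_mem(1)] hom_free_action[OF p(1) one_mem(1)]
    by metis
  then have "(f j - g j) * \<phi> 1 = theta j (\<phi> 1)"
    using p(2) j assms(1) by (simp add: gen_action_D algebra_simps)
  then show ?thesis
    by (rule mult_eq_theta_imp_Ints) (rule hom_one_nonzero)
qed

end

lemma module_isomorphic_M_free_if:
  assumes omega1: "omega_data \<nu> \<mu> f a" and omega2: "omega_data \<nu> \<mu> g b"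
    and ab: "\<forall>j\<in>{\<mu>..\<nu>}. a j = b j" and fg: "\<forall>j\<in>{1..<\<mu>}. f j - g j \<in> \<int>"
  shows "module_isomorphic (freeB \<nu>) (M_free \<nu> \<mu> f a) (M_free \<nu> \<mu> g b)"
proof -
  have "\<forall>j\<in>{1..<\<mu>}. \<exists>n. f j - g j = of_int n"
    using fg by (auto elim!: Ints_cases)
  then obtain n where n: "\<And>j. j \<in> {1..<\<mu>} \<Longrightarrow> f j - g j = of_int (n j)"
    by metis
  \<comment> \<open>Multiplication by this monomial turns \<open>theta j\<close> plus f_j into
    \<open>theta j\<close> plus g_j: the Leibniz rule contributes the integer \<open>n j\<close>. It
    is bijective because only invertible variables occur.\<close>
  define T where "T = (\<lambda>n. \<Prod>j\<in>{1..<\<mu>}. var_pow j (n j))"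
  have T_mem: "T m \<in> mixed_ring \<nu> \<mu>" for m
    unfolding T_def using omega_rank[OF omega1] by (intro prod_var_pow_mixed_ring) auto
  have T_inv: "T (\<lambda>j. - n j) * T n = 1" "T n * T (\<lambda>j. - n j) = 1"
    by (simp_all add: T_def flip: prod.distrib var_pow_add)
  have T_free: "T n \<in> free_of (set [\<mu>..<\<nu> + 1])"
    unfolding T_def by (rule prod_var_pow_free_of) auto
  have T_theta: "theta j (T n) = of_int (n j) * T n" if "j \<in> {1..<\<mu>}" for j
    unfolding T_def using that by (intro theta_prod_var_pow) auto
  have gen: "T n * gen_action \<nu> \<mu> f a x h = gen_action \<nu> \<mu> g b x (T n * h)"
    if "x \<in> generators \<nu>" for x h
  proof -
    consider \<alpha> where "x = E \<alpha>" | j where "x = D j" "j \<in> {1..\<nu>}"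
      using \<open>x \<in> generators \<nu>\<close> by (auto simp: generators_def)
    then show ?thesis
    proof cases
      case 1
      have "fold_shift a \<alpha> [\<mu>..<\<nu> + 1] h = fold_shift b \<alpha> [\<mu>..<\<nu> + 1] h"
        using ab by (intro fold_shift_cong) auto
      then show ?thesis
        unfolding 1 gen_action_E fold_shift_free_of_mult[OF T_free] by (simp only: mult_ac)
    next
      case 2
      then show ?thesis
        using T_theta[of j] n[of j]
        by (auto simp: gen_action_D theta_mult algebra_simps)
    qed
  qed
  have "T n * free_action \<nu> \<mu> f a p h = free_action \<nu> \<mu> g b p (T n * h)"
    if "p \<in> carrier (freeB \<nu>)" for p h
    using that
    by (induction p arbitrary: h rule: carrier_free_algebra_induct)
      (simp_all add: free_action_scalar free_action_add free_action_mult free_action_gen gen distrib_left mult_ac)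
  then have "(\<lambda>h. T n * h) \<in> module_hom (freeB \<nu>) (M_free \<nu> \<mu> f a) (M_free \<nu> \<mu> g b)"
    by (simp add: module_hom_def mixed_ring_mult T_mem distrib_left)
  moreover have "bij_betw (\<lambda>h. T n * h) (mixed_ring \<nu> \<mu>) (mixed_ring \<nu> \<mu>)"
    by (rule bij_betw_byWitness[where f' = "\<lambda>h. T (\<lambda>j. - n j) * h"])
      (auto simp: T_inv mixed_ring_mult T_mem simp flip: mult.assoc)
  ultimately show ?thesis
    by (auto simp: module_isomorphic_def)
qed

lemma module_isomorphic_M_free_iff:
  assumes omega1: "omega_data \<nu> \<mu> f a" and omega2: "omega_data \<nu> \<gamma> g b"
  shows "module_isomorphic (freeB \<nu>) (M_free \<nu> \<mu> f a) (M_free \<nu> \<gamma> g b) \<longleftrightarrow>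
    \<mu> = \<gamma> \<and> (\<forall>j\<in>{\<mu>..\<nu>}. a j = b j) \<and> (\<forall>j\<in>{1..<\<mu>}. f j - g j \<in> \<int>)"
proof
  assume iso: "module_isomorphic (freeB \<nu>) (M_free \<nu> \<mu> f a) (M_free \<nu> \<gamma> g b)"
  obtain \<phi> where \<phi>: "\<phi> \<in> module_hom (freeB \<nu>) (M_free \<nu> \<mu> f a) (M_free \<nu> \<gamma> g b)"
    "inj_on \<phi> (mixed_ring \<nu> \<mu>)"
    using iso by (auto simp: module_isomorphic_def bij_betw_def)
  obtain \<psi> where \<psi>: "\<psi> \<in> module_hom (freeB \<nu>) (M_free \<nu> \<gamma> g b) (M_free \<nu> \<mu> f a)"
    "inj_on \<psi> (mixed_ring \<nu> \<gamma>)"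
    using module_isomorphic_sym[OF left_module_M_free[OF omega1] iso]
    by (auto simp: module_isomorphic_def bij_betw_def)
  \<comment> \<open>\<open>hom_rank_le\<close> is one-sided, hence the use of an isomorphism in each
    direction.\<close>
  have "\<mu> = \<gamma>"
    using hom_rank_le[OF omega1 omega2 \<phi>] hom_rank_le[OF omega2 omega1 \<psi>] by simp
  then show "\<mu> = \<gamma> \<and> (\<forall>j\<in>{\<mu>..\<nu>}. a j = b j) \<and> (\<forall>j\<in>{1..<\<mu>}. f j - g j \<in> \<int>)"
    using hom_scalars_eq[OF omega1 omega2 \<phi>] hom_potentials_diff[OF omega1 omega2 \<phi>] by blast
next
  assume "\<mu> = \<gamma> \<and> (\<forall>j\<in>{\<mu>..\<nu>}. a j = b j) \<and> (\<forall>j\<in>{1..<\<mu>}. f j - g j \<in> \<int>)"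
  then show "module_isomorphic (freeB \<nu>) (M_free \<nu> \<mu> f a) (M_free \<nu> \<gamma> g b)"
    using module_isomorphic_M_free_if omega1 omega2 by blast
qed

theorem corollary3p6:
  fixes \<nu> \<mu> :: nat
    and f :: "nat \<Rightarrow> laurent"
    and a :: "nat \<Rightarrow> complex"
  assumes "\<nu> \<ge> 1"
    and "omega_data \<nu> \<mu> f a"
  shows "((is_A_module \<nu> \<mu> f a \<and> simple_module (algA \<nu>) (M_A \<nu> \<mu> f a)) \<longleftrightarrow>
            (\<exists>P Q. P \<in> laurent_in {1..<\<mu>} \<and>
               (\<forall>j\<in>{1..<\<mu>}. Q j \<in> laurent_in {j} \<and> f j = var j * partial j P + Q j)))
       \<and> (\<forall>\<gamma> g b. omega_data \<nu> \<gamma> g b \<longrightarrow>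
            is_A_module \<nu> \<mu> f a \<longrightarrow> is_A_module \<nu> \<gamma> g b \<longrightarrow>
            (module_isomorphic (algA \<nu>) (M_A \<nu> \<mu> f a) (M_A \<nu> \<gamma> g b) \<longleftrightarrow>
               \<mu> = \<gamma> \<and> (\<forall>j\<in>{\<mu>..\<nu>}. a j = b j) \<and> (\<forall>j\<in>{1..<\<mu>}. f j - g j \<in> \<int>)))"
proof (intro conjI allI impI)
  have "is_A_module \<nu> \<mu> f a \<and> simple_module (algA \<nu>) (M_A \<nu> \<mu> f a) \<longleftrightarrow> is_A_module \<nu> \<mu> f a"
    using simple_module_M_A_iff[OF assms(2)] simple_module_M_free[OF assms(2)] by blast
  also have "\<dots> \<longleftrightarrow> (\<exists>P Q. P \<in> laurent_in {1..<\<mu>} \<and>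
      (\<forall>j\<in>{1..<\<mu>}. Q j \<in> laurent_in {j} \<and> f j = var j * partial j P + Q j))"
    unfolding is_A_module_iff[OF assms(2)]
    by (rule theta_commuting_iff_potential) (use omega_mem[OF assms(2)] in blast)
  finally show "(is_A_module \<nu> \<mu> f a \<and> simple_module (algA \<nu>) (M_A \<nu> \<mu> f a)) \<longleftrightarrow>
      (\<exists>P Q. P \<in> laurent_in {1..<\<mu>} \<and>
        (\<forall>j\<in>{1..<\<mu>}. Q j \<in> laurent_in {j} \<and> f j = var j * partial j P + Q j))" .
next
  fix \<gamma> g b
  assume "omega_data \<nu> \<gamma> g b" "is_A_module \<nu> \<mu> f a" "is_A_module \<nu> \<gamma> g b"
  then show "module_isomorphic (algA \<nu>) (M_A \<nu> \<mu> f a) (M_A \<nu> \<gamma> g b) \<longleftrightarrow>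
      \<mu> = \<gamma> \<and> (\<forall>j\<in>{\<mu>..\<nu>}. a j = b j) \<and> (\<forall>j\<in>{1..<\<mu>}. f j - g j \<in> \<int>)"
    using module_isomorphic_M_A_iff[OF assms(2)] module_isomorphic_M_free_iff[OF assms(2)] by blast
qed

end
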